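(* Let $V$ be a finite-dimensional $\mathcal D_m$-module with character $\chi^V$, and suppose $f\in\mathcal Q$ satisfies $\theta(f)=\chi^V$. Let $\Gamma=\Gamma(\mathcal D_m,\mathrm{supp}(f))$ be the Cayley graph with weights $\omega(g)=[g]f$ for $g\in\mathrm{supp}(f)$, and for each basis element $b_i$ of $\mathcal Q$ let $\sigma_i\in\mathrm{supp}(b_i)$. Then for every simple $\mathcal D_m$-module $V^{(k)}$, with character $\chi^{(k)}$, and every $d\ge0$, the multiplicity of $V^{(k)}$ in $V^{\otimes d}$ is equal to $$\sum_{b_i:\ \theta(b_i)=\chi^{(k)}}\ \sum_{w\in w(\sigma_i,d;\Gamma)}\omega(w).$$
   Context: $\mathcal D_m=\langle s,r\mid s^2=r^m=srsr=e\rangle$, $m\ge3$, is the dihedral group of order $2m$; modules are over $\mathbb C$, with diagonal action on $V^{\otimes d}$. Its irreducible characters are: $id$ (trivial); $\epsilon$ with $\epsilon(r)=1,\epsilon(s)=-1$; when $m$ is even also $\gamma$ with $\gamma(r)=-1,\gamma(s)=1$, and the product $\gamma\epsilon$; and the two-dimensional characters $\chi_j$ with $\chi_j(r^a)=2\cos(2\pi ja/m)$, $\chi_j(r^as)=0$, for $1\le j\le k-1$ if $m=2k$ and $1\le j\le k$ if $m=2k+1$. $\mathbb R\,\mathrm{Irr}(\mathcal D_m)$ is the algebra of real linear combinations of irreducible characters with pointwise product. Put $y_i=r^{1-i}s+r^i\in\mathbb R\mathcal D_m$. If $m=2k$, $\mathcal Q\subseteq\mathbb R\mathcal D_m$ is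 the span of the basis $\{b_i\}=\{e,r^k,rs,r^{k+1}s\}\cup\{y_i,\,y_irs: 1\le i\le k-1\}$, and $\theta:\mathcal Q\to\mathbb R\,\mathrm{Irr}(\mathcal D_m)$ is the linear map with $\theta(e)=id$, $\theta(rs)=\epsilon$, $\theta(r^k)=\gamma$, $\theta(r^{k+1}s)=\gamma\epsilon$, $\theta(y_i)=\theta(y_irs)=\chi_i$. If $m=2k+1$, $\mathcal Q$ is the span of the basis $\{b_i\}=\{e,rs\}\cup\{y_i,\,y_irs:1\le i\le k\}$ and $\theta(e)=id$, $\theta(rs)=\epsilon$, $\theta(y_i)=\theta(y_irs)=\chi_i$. (In both cases $\mathcal Q$ is a subalgebra and $\theta$ a surjective algebra morphism.) For $f\in\mathbb R\mathcal D_m$, $[g]f$ is the coefficient of $g$ in $f$ and $\mathrm{supp}(f)=\{g:[g]f\neq0\}$. In the Cayley graph $\Gamma(G,S)$ there is a directed edge $g\to gs$ for each $g\in G,s\in S$ ($S$ need not generate $G$). $w(g,d;\Gamma)$ is the set of words of length $d$ which reduce to $g$, i.e. sequences $(s_1,\dots,s_d)\in S^d$ with $s_1\cdots s_d=g$ in $G$. The weight of $w=s_1\cdots s_d$ is $\omega(w)=\omega(s_1)\cdots\omega(s_d)$. *)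

theory Defs
  imports Complex_Main "HOL-Algebra.Algebra" "Jordan_Normal_Form.VS_Connect"
begin

section \<open>The dihedral group\<close>

text \<open>The element \<open>r\<^sup>a s\<^sup>b\<close> is encoded as \<open>(a, b)\<close> with \<open>0 \<le> a < m\<close>; the product is read off
  from \<open>s r = r\<^sup>-\<^sup>1 s\<close>. The lemmas of this section show that this is a group of order \<open>2m\<close>
  generated by \<open>s, r\<close> subject to \<open>s\<^sup>2 = r\<^sup>m = srsr = e\<close>, for every \<open>m \<ge> 3\<close>.\<close>

type_synonym dih = "int \<times> bool"

definition dihedral :: "nat \<Rightarrow> dih monoid" where
  "dihedral m = \<lparr> carrier = {0..<int m} \<times> UNIV,
     monoid.mult = (\<lambda>(a, x) (b, y). ((if x then a - b else a + b) mod int m, x \<noteq> y)),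
     one = (0, False) \<rparr>"

definition dih_r :: dih where "dih_r = (1, False)"
definition dih_s :: dih where "dih_s = (0, True)"

lemma dihedral_simps [simp]:
  "carrier (dihedral m) = {0..<int m} \<times> UNIV"
  "\<one>\<^bsub>dihedral m\<^esub> = (0, False)"
  "(a, x) \<otimes>\<^bsub>dihedral m\<^esub> (b, y) = ((if x then a - b else a + b) mod int m, x \<noteq> y)"
  by (simp_all add: dihedral_def)

lemma group_dihedral:
  assumes "m \<ge> 3" shows "group (dihedral m)"
proof (rule groupI)
  fix u v w assume "u \<in> carrier (dihedral m)" "v \<in> carrier (dihedral m)" "w \<in> carrier (dihedral m)"
  then show "u \<otimes>\<^bsub>dihedral m\<^esub> v \<otimes>\<^bsub>dihedral m\<^esub> w = u \<otimes>\<^bsub>dihedral m\<^esub> (v \<otimes>\<^bsub>dihedral m\<^esub> w)"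
    by (cases u; cases v; cases w) (auto simp: mod_simps algebra_simps split: if_splits)
next
  fix u assume u: "u \<in> carrier (dihedral m)"
  obtain a x where [simp]: "u = (a, x)" by (cases u)
  show "\<exists>y\<in>carrier (dihedral m). y \<otimes>\<^bsub>dihedral m\<^esub> u = \<one>\<^bsub>dihedral m\<^esub>"
    by (rule bexI[of _ "(if x then a else (- a) mod int m, x)"]) (use u assms in \<open>auto simp: mod_simps\<close>)
qed (use assms in auto)

lemma order_dihedral: "Coset.order (dihedral m) = 2 * m"
  by (simp add: Coset.order_def card_cartesian_product)

lemma dih_r_pow_nat:
  "m \<ge> 3 \<Longrightarrow> dih_r [^]\<^bsub>dihedral m\<^esub> (a :: nat) = (int a mod int m, False)"
  by (induction a) (auto simp: dih_r_def nat_pow_def mod_simps add.commute)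

lemma dih_r_pow_int:
  assumes "m \<ge> 3"
  shows "dih_r [^]\<^bsub>dihedral m\<^esub> (a :: int) = (a mod int m, False)"
proof (cases "a \<ge> 0")
  case True
  then obtain k where "a = int k" using nonneg_int_cases by blast
  then show ?thesis using dih_r_pow_nat[OF assms] by (simp add: int_pow_int)
next
  case False
  then obtain k where a: "a = - int k" using nonneg_int_cases[of "- a"] by (metis minus_minus neg_0_le_iff_le linear)
  interpret group "dihedral m" by (rule group_dihedral[OF assms])
  have "inv\<^bsub>dihedral m\<^esub> (int k mod int m, False) = ((- int k) mod int m, False)"
    by (rule inv_equality) (use assms in \<open>auto simp: mod_simps\<close>)
  then show ?thesis
    using a dih_r_pow_nat[OF assms, of k] assms
    by (simp add: int_pow_neg_int dih_r_def)
qed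

lemma dihedral_relations:
  assumes "m \<ge> 3"
  shows "dih_s \<in> carrier (dihedral m)" "dih_r \<in> carrier (dihedral m)"
    "dih_s [^]\<^bsub>dihedral m\<^esub> (2 :: nat) = \<one>\<^bsub>dihedral m\<^esub>"
    "dih_r [^]\<^bsub>dihedral m\<^esub> m = \<one>\<^bsub>dihedral m\<^esub>"
    "dih_s \<otimes>\<^bsub>dihedral m\<^esub> dih_r \<otimes>\<^bsub>dihedral m\<^esub> dih_s \<otimes>\<^bsub>dihedral m\<^esub> dih_r = \<one>\<^bsub>dihedral m\<^esub>"
  using assms dih_r_pow_nat[OF assms, of m]
  by (auto simp: dih_r_def dih_s_def numeral_2_eq_2 nat_pow_def mod_simps)

lemma dihedral_normal_form:
  assumes "m \<ge> 3" "(a, x) \<in> carrier (dihedral m)"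
  shows "(a, x) = dih_r [^]\<^bsub>dihedral m\<^esub> a \<otimes>\<^bsub>dihedral m\<^esub> (if x then dih_s else \<one>\<^bsub>dihedral m\<^esub>)"
  using assms by (simp add: dih_r_pow_int dih_s_def)

lemma dihedral_generate:
  assumes "m \<ge> 3"
  shows "generate (dihedral m) {dih_s, dih_r} = carrier (dihedral m)"
proof
  interpret group "dihedral m" by (rule group_dihedral[OF assms])
  have sub: "{dih_s, dih_r} \<subseteq> carrier (dihedral m)" using dihedral_relations[OF assms] by blast
  then show "generate (dihedral m) {dih_s, dih_r} \<subseteq> carrier (dihedral m)"
    by (rule generate_incl)
  interpret H: subgroup "generate (dihedral m) {dih_s, dih_r}" "dihedral m"
    by (rule generate_is_subgroup[OF sub])
  have rs: "dih_r \<in> generate (dihedral m) {dih_s, dih_r}"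
    "dih_s \<in> generate (dihedral m) {dih_s, dih_r}"
    by (auto intro: generate.incl)
  have pow: "dih_r [^]\<^bsub>dihedral m\<^esub> (k :: nat) \<in> generate (dihedral m) {dih_s, dih_r}" for k
    by (induction k) (use rs in \<open>auto simp: nat_pow_def intro: H.m_closed generate.one[of "dihedral m", simplified]\<close>)
  show "carrier (dihedral m) \<subseteq> generate (dihedral m) {dih_s, dih_r}"
  proof
    fix u assume u: "u \<in> carrier (dihedral m)"
    obtain a x where ax: "u = (a, x)" by (cases u)
    then obtain k where k: "a = int k" using u nonneg_int_cases[of a] by auto
    have "u = dih_r [^]\<^bsub>dihedral m\<^esub> k \<otimes>\<^bsub>dihedral m\<^esub> (if x then dih_s else \<one>\<^bsub>dihedral m\<^esub>)"
      using dihedral_normal_form[OF assms, of a x] u ax k by (simp only: int_pow_int)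
    then show "u \<in> generate (dihedral m) {dih_s, dih_r}"
      using H.m_closed[OF pow[of k] rs(2)] H.m_closed[OF pow[of k] H.one_closed] by (cases x) (simp_all only: if_True if_False)
  qed
qed


section \<open>Irreducible characters, the subspace \<open>\<Q>\<close> and the map \<open>\<theta>\<close>\<close>

definition chi_id :: "dih \<Rightarrow> complex" where
  "chi_id g = 1"

definition chi_eps :: "dih \<Rightarrow> complex" where
  "chi_eps = (\<lambda>(a, x). if x then - 1 else 1)"

text \<open>\<open>\<gamma>(r\<^sup>a s\<^sup>b) = (- 1)\<^sup>a\<close>; used for even \<open>m\<close> only.\<close>

definition chi_gamma :: "dih \<Rightarrow> complex" where
  "chi_gamma = (\<lambda>(a, x). (- 1) powi a)"

definition chi_two :: "nat \<Rightarrow> nat \<Rightarrow> dih \<Rightarrow> complex" where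
  "chi_two m j = (\<lambda>(a, x). if x then 0 else complex_of_real (2 * cos (2 * pi * real j * real_of_int a / real m)))"

text \<open>Elements of the real group algebra are functions \<open>G \<Rightarrow> \<real>\<close>, multiplied by convolution.\<close>

definition ga_elem :: "'g \<Rightarrow> 'g \<Rightarrow> real" where
  "ga_elem g = (\<lambda>x. if x = g then 1 else 0)"

definition ga_mult :: "('g, 'b) monoid_scheme \<Rightarrow> ('g \<Rightarrow> real) \<Rightarrow> ('g \<Rightarrow> real) \<Rightarrow> 'g \<Rightarrow> real" where
  "ga_mult G f h = (\<lambda>x. \<Sum>u\<in>carrier G. \<Sum>v\<in>carrier G. if u \<otimes>\<^bsub>G\<^esub> v = x then f u * h v else 0)"

definition supp :: "('g \<Rightarrow> real) \<Rightarrow> 'g set" where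
  "supp f = {g. f g \<noteq> 0}"

definition y_elem :: "nat \<Rightarrow> nat \<Rightarrow> dih \<Rightarrow> real" where
  "y_elem m i = (\<lambda>g. ga_elem (dih_r [^]\<^bsub>dihedral m\<^esub> (1 - int i) \<otimes>\<^bsub>dihedral m\<^esub> dih_s) g
                    + ga_elem (dih_r [^]\<^bsub>dihedral m\<^esub> i) g)"

text \<open>Names for the basis elements \<open>e, rs, r\<^sup>k, r\<^sup>k\<^sup>+\<^sup>1 s, y\<^sub>i, y\<^sub>i rs\<close>, where \<open>k = m div 2\<close>.\<close>

datatype basis_index = B_e | B_rs | B_rk | B_rk1s | B_y nat | B_yrs nat

definition basis_indices :: "nat \<Rightarrow> basis_index set" where
  "basis_indices m =
     (if even m then {B_e, B_rk, B_rs, B_rk1s} \<union> B_y ` {1..m div 2 - 1} \<union> B_yrs ` {1..m div 2 - 1}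
      else {B_e, B_rs} \<union> B_y ` {1..m div 2} \<union> B_yrs ` {1..m div 2})"

fun basis_elem :: "nat \<Rightarrow> basis_index \<Rightarrow> dih \<Rightarrow> real" where
  "basis_elem m B_e = ga_elem \<one>\<^bsub>dihedral m\<^esub>"
| "basis_elem m B_rs = ga_elem (dih_r \<otimes>\<^bsub>dihedral m\<^esub> dih_s)"
| "basis_elem m B_rk = ga_elem (dih_r [^]\<^bsub>dihedral m\<^esub> (m div 2))"
| "basis_elem m B_rk1s = ga_elem (dih_r [^]\<^bsub>dihedral m\<^esub> (m div 2 + 1) \<otimes>\<^bsub>dihedral m\<^esub> dih_s)"
| "basis_elem m (B_y i) = y_elem m i"
| "basis_elem m (B_yrs i) = ga_mult (dihedral m) (y_elem m i) (ga_elem (dih_r \<otimes>\<^bsub>dihedral m\<^esub> dih_s))"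

fun basis_char :: "nat \<Rightarrow> basis_index \<Rightarrow> dih \<Rightarrow> complex" where
  "basis_char m B_e = chi_id"
| "basis_char m B_rs = chi_eps"
| "basis_char m B_rk = chi_gamma"
| "basis_char m B_rk1s = (\<lambda>g. chi_gamma g * chi_eps g)"
| "basis_char m (B_y i) = chi_two m i"
| "basis_char m (B_yrs i) = chi_two m i"

definition basis_comb :: "nat \<Rightarrow> (basis_index \<Rightarrow> real) \<Rightarrow> dih \<Rightarrow> real" where
  "basis_comb m c = (\<lambda>g. \<Sum>i\<in>basis_indices m. c i * basis_elem m i g)"

definition Q_alg :: "nat \<Rightarrow> (dih \<Rightarrow> real) set" where
  "Q_alg m = range (basis_comb m)"

text \<open>Coordinates with respect to the basis; they are unique by \<open>basis_coords_comb\<close> below.\<close>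

definition basis_coords :: "nat \<Rightarrow> (dih \<Rightarrow> real) \<Rightarrow> basis_index \<Rightarrow> real" where
  "basis_coords m f = (THE c. (\<forall>i. i \<notin> basis_indices m \<longrightarrow> c i = 0) \<and> f = basis_comb m c)"

definition theta :: "nat \<Rightarrow> (dih \<Rightarrow> real) \<Rightarrow> dih \<Rightarrow> complex" where
  "theta m f = (\<lambda>g. \<Sum>i\<in>basis_indices m. complex_of_real (basis_coords m f i) * basis_char m i g)"

lemma ga_mult_elem:
  assumes "finite (carrier G)" "a \<in> carrier G" "b \<in> carrier G" "h \<in> carrier G"
  shows "ga_mult G (\<lambda>g. ga_elem a g + ga_elem b g) (ga_elem h) =
    (\<lambda>g. ga_elem (a \<otimes>\<^bsub>G\<^esub> h) g + ga_elem (b \<otimes>\<^bsub>G\<^esub> h) g)"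
proof
  fix x
  have "(\<Sum>v\<in>carrier G. if u \<otimes>\<^bsub>G\<^esub> v = x then (ga_elem a u + ga_elem b u) * ga_elem h v else 0) =
      (if u = a then ga_elem (a \<otimes>\<^bsub>G\<^esub> h) x else 0) + (if u = b then ga_elem (b \<otimes>\<^bsub>G\<^esub> h) x else 0)" for u
  proof -
    have "(\<Sum>v\<in>carrier G. if u \<otimes>\<^bsub>G\<^esub> v = x then (ga_elem a u + ga_elem b u) * ga_elem h v else 0) =
        (\<Sum>v\<in>carrier G. if v = h then (if u \<otimes>\<^bsub>G\<^esub> h = x then ga_elem a u + ga_elem b u else 0) else 0)"
      by (rule sum.cong) (auto simp: ga_elem_def)
    also have "\<dots> = (if u \<otimes>\<^bsub>G\<^esub> h = x then ga_elem a u + ga_elem b u else 0)"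
      using assms by (simp add: sum.delta)
    finally show ?thesis by (auto simp: ga_elem_def)
  qed
  then show "ga_mult G (\<lambda>g. ga_elem a g + ga_elem b g) (ga_elem h) x =
      ga_elem (a \<otimes>\<^bsub>G\<^esub> h) x + ga_elem (b \<otimes>\<^bsub>G\<^esub> h) x"
    using assms by (simp add: ga_mult_def sum.distrib sum.delta)
qed

lemma y_elem_eq:
  assumes "m \<ge> 3"
  shows "y_elem m i = (\<lambda>g. ga_elem ((1 - int i) mod int m, True) g + ga_elem (int i mod int m, False) g)"
  using assms by (simp add: y_elem_def dih_r_pow_int dih_r_pow_nat dih_s_def)

lemma y_elem_rs_eq:
  assumes "m \<ge> 3"
  shows "basis_elem m (B_yrs i) =
    (\<lambda>g. ga_elem ((- int i) mod int m, False) g + ga_elem ((int i + 1) mod int m, True) g)"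
  using assms
  by (simp add: y_elem_eq ga_mult_elem dih_r_def dih_s_def mod_simps)

fun basis_rep :: "nat \<Rightarrow> basis_index \<Rightarrow> dih" where
  "basis_rep m B_e = (0, False)"
| "basis_rep m B_rs = (1, True)"
| "basis_rep m B_rk = (int (m div 2), False)"
| "basis_rep m B_rk1s = (int (m div 2) + 1, True)"
| "basis_rep m (B_y i) = (int i, False)"
| "basis_rep m (B_yrs i) = (int i + 1, True)"

lemma finite_basis_indices [simp]: "finite (basis_indices m)"
  by (simp add: basis_indices_def)

lemma basis_elem_basis_rep:
  assumes m: "m \<ge> 3" and "i \<in> basis_indices m" "j \<in> basis_indices m"
  shows "basis_elem m j (basis_rep m i) = (if i = j then 1 else 0)"
proof -
  have n1: "(1 - int a) mod int m = (if a = 1 then 0 else int m + 1 - int a)" if "1 \<le> a" "a \<le> m" for a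
  proof (cases "a = 1")
    case False
    have "(1 - int a) mod int m = (1 - int a + int m) mod int m" by simp
    also have "\<dots> = int m + 1 - int a" using False that by (subst mod_pos_pos_trivial) auto
    finally show ?thesis using False by simp
  qed simp
  have n2: "(- int a) mod int m = int m - int a" if "1 \<le> a" "a < m" for a
  proof -
    have "(- int a) mod int m = (- int a + int m) mod int m" by simp
    also have "\<dots> = int m - int a" using that by (subst mod_pos_pos_trivial) auto
    finally show ?thesis .
  qed
  have n3: "int a mod int m = int a" if "a < m" for a using that by simp
  have n4: "(int a + 1) mod int m = int a + 1" if "a + 1 < m" for a using that by simp
  have K: "int (m div 2) + 1 < int m" using m by linarith
  have k: "int (m div 2) mod int m = int (m div 2)" "int (m div 2 + 1) mod int m = int (m div 2) + 1"
    "(int (m div 2) + 1) mod int m = int (m div 2) + 1"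
    using K by auto
  have E: "basis_elem m B_e = ga_elem (0, False)" "basis_elem m B_rs = ga_elem (1, True)"
    "basis_elem m B_rk = ga_elem (int (m div 2), False)"
    "basis_elem m B_rk1s = ga_elem (int (m div 2) + 1, True)"
    unfolding basis_elem.simps dih_r_pow_nat[OF m] k dih_s_def
    using m k by (simp_all add: dih_r_def)
  have Y: "basis_elem m (B_y a) = (\<lambda>g. ga_elem (if a = 1 then 0 else int m + 1 - int a, True) g + ga_elem (int a, False) g)"
    "basis_elem m (B_yrs a) = (\<lambda>g. ga_elem (int m - int a, False) g + ga_elem (int a + 1, True) g)"
    if "1 \<le> a" "a \<le> m div 2" for a
    using that m y_elem_eq[OF m, of a] y_elem_rs_eq[OF m, of a] n1[of a] n2[of a] n3[of a] n4[of a]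
    by (auto simp del: basis_elem.simps(6))
  show ?thesis
  proof (cases "even m")
    case True
    then obtain k where mk: "m = 2 * k" by (elim evenE)
    then have d: "m div 2 = k" by simp
    show ?thesis using assms mk
      by (auto simp: basis_indices_def Y[unfolded mk d[unfolded mk]] E[unfolded mk d[unfolded mk]] ga_elem_def
               simp del: basis_elem.simps split: if_splits; arith)
  next
    case False
    then obtain k where mk: "m = Suc (2 * k)" by (elim oddE) simp
    then have d: "m div 2 = k" by simp
    show ?thesis using assms mk
      by (auto simp: basis_indices_def Y[unfolded mk d[unfolded mk]] E[unfolded mk d[unfolded mk]] ga_elem_def
               simp del: basis_elem.simps split: if_splits; arith)
  qed
qed

lemma basis_comb_basis_rep:
  assumes "m \<ge> 3" "i \<in> basis_indices m"
  shows "basis_comb m c (basis_rep m i) = c i"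
proof -
  have "basis_comb m c (basis_rep m i) = (\<Sum>j\<in>basis_indices m. if i = j then c j else 0)"
    unfolding basis_comb_def by (rule sum.cong) (use assms basis_elem_basis_rep in auto)
  then show ?thesis using assms by simp
qed

lemma basis_coords_comb:
  assumes "m \<ge> 3"
  shows "basis_coords m (basis_comb m c) = (\<lambda>i. if i \<in> basis_indices m then c i else 0)"
  unfolding basis_coords_def
proof (rule the_equality)
  show "(\<forall>i. i \<notin> basis_indices m \<longrightarrow> (if i \<in> basis_indices m then c i else 0) = 0) \<and>
      basis_comb m c = basis_comb m (\<lambda>i. if i \<in> basis_indices m then c i else 0)"
    by (auto simp: basis_comb_def intro!: sum.cong)
next
  fix c' assume c': "(\<forall>i. i \<notin> basis_indices m \<longrightarrow> c' i = 0) \<and> basis_comb m c = basis_comb m c'"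
  show "c' = (\<lambda>i. if i \<in> basis_indices m then c i else 0)"
  proof
    fix i show "c' i = (if i \<in> basis_indices m then c i else 0)"
      using c' basis_comb_basis_rep[OF assms, of i c] basis_comb_basis_rep[OF assms, of i c'] by auto
  qed
qed

lemma theta_comb:
  assumes "m \<ge> 3"
  shows "theta m (basis_comb m c) = (\<lambda>g. \<Sum>i\<in>basis_indices m. complex_of_real (c i) * basis_char m i g)"
  unfolding theta_def basis_coords_comb[OF assms] by (auto intro!: sum.cong)

lemma theta_basis_elem:
  assumes "m \<ge> 3" "i \<in> basis_indices m"
  shows "theta m (basis_elem m i) = basis_char m i"
proof -
  have "basis_elem m i = basis_comb m (\<lambda>j. if j = i then 1 else 0)"
    using assms by (auto simp: basis_comb_def if_distribR if_distrib[of "\<lambda>x. x * _"] cong: if_cong)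
  then show ?thesis
    using assms by (simp only: theta_comb) (auto simp: if_distrib[of complex_of_real] if_distrib[of "\<lambda>x. x * _"] cong: if_cong)
qed



section \<open>Finite-dimensional modules over \<open>\<complex>\<close> as matrix representations\<close>

definition mat_rep :: "('g, 'b) monoid_scheme \<Rightarrow> nat \<Rightarrow> ('g \<Rightarrow> complex mat) \<Rightarrow> bool" where
  "mat_rep G n \<rho> \<longleftrightarrow> (\<forall>g\<in>carrier G. \<rho> g \<in> carrier_mat n n) \<and> \<rho> \<one>\<^bsub>G\<^esub> = 1\<^sub>m n \<and>
     (\<forall>g\<in>carrier G. \<forall>h\<in>carrier G. \<rho> (g \<otimes>\<^bsub>G\<^esub> h) = \<rho> g * \<rho> h)"

definition submodule_of :: "('g, 'b) monoid_scheme \<Rightarrow> nat \<Rightarrow> ('g \<Rightarrow> complex mat) \<Rightarrow> complex vec set \<Rightarrow> bool" where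
  "submodule_of G n \<rho> W \<longleftrightarrow> subspace class_ring W (module_vec TYPE(complex) n) \<and>
     (\<forall>g\<in>carrier G. \<forall>w\<in>W. \<rho> g *\<^sub>v w \<in> W)"

definition simple_rep :: "('g, 'b) monoid_scheme \<Rightarrow> nat \<Rightarrow> ('g \<Rightarrow> complex mat) \<Rightarrow> bool" where
  "simple_rep G n \<rho> \<longleftrightarrow> mat_rep G n \<rho> \<and> n > 0 \<and>
     (\<forall>W. submodule_of G n \<rho> W \<longrightarrow> W = {0\<^sub>v n} \<or> W = carrier_vec n)"

definition iso_rep :: "('g, 'b) monoid_scheme \<Rightarrow> ('g \<Rightarrow> complex mat) \<Rightarrow> ('g \<Rightarrow> complex mat) \<Rightarrow> bool" where
  "iso_rep G \<rho> \<tau> \<longleftrightarrow> (\<exists>P Q. \<forall>g\<in>carrier G. similar_mat_wit (\<rho> g) (\<tau> g) P Q)"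

definition direct_sum_rep :: "('g \<Rightarrow> complex mat) list \<Rightarrow> 'g \<Rightarrow> complex mat" where
  "direct_sum_rep \<rho>s = (\<lambda>g. diag_block_mat (map (\<lambda>\<rho>. \<rho> g) \<rho>s))"

text \<open>The number of summands isomorphic to \<open>\<tau>\<close> in a decomposition of \<open>\<rho>\<close> into simple modules.\<close>

definition multiplicity_rep :: "('g, 'b) monoid_scheme \<Rightarrow> ('g \<Rightarrow> complex mat) \<Rightarrow> ('g \<Rightarrow> complex mat) \<Rightarrow> nat" where
  "multiplicity_rep G \<tau> \<rho> = (THE k. \<exists>\<rho>s. (\<forall>\<rho>'\<in>set \<rho>s. \<exists>n. simple_rep G n \<rho>') \<and>
     iso_rep G \<rho> (direct_sum_rep \<rho>s) \<and> k = length (filter (iso_rep G \<tau>) \<rho>s))"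

definition rep_char :: "('g \<Rightarrow> complex mat) \<Rightarrow> 'g \<Rightarrow> complex" where
  "rep_char \<rho> = (\<lambda>g. \<Sum>i<dim_row (\<rho> g). \<rho> g $$ (i, i))"

text \<open>The matrix of \<open>A \<otimes> B\<close> in the lexicographically ordered basis \<open>e\<^sub>i \<otimes> e\<^sub>j\<close>.\<close>

definition kronecker :: "complex mat \<Rightarrow> complex mat \<Rightarrow> complex mat" where
  "kronecker A B = mat (dim_row A * dim_row B) (dim_col A * dim_col B)
     (\<lambda>(i, j). A $$ (i div dim_row B, j div dim_col B) * B $$ (i mod dim_row B, j mod dim_col B))"

fun tensor_power_rep :: "nat \<Rightarrow> ('g \<Rightarrow> complex mat) \<Rightarrow> 'g \<Rightarrow> complex mat" where
  "tensor_power_rep 0 \<rho> = (\<lambda>g. 1\<^sub>m 1)"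
| "tensor_power_rep (Suc d) \<rho> = (\<lambda>g. kronecker (\<rho> g) (tensor_power_rep d \<rho> g))"


section \<open>Weighted words in Cayley graphs\<close>

text \<open>\<open>cayley_words G S g d\<close> is \<open>w(g, d; \<Gamma>(G, S))\<close>: the label sequences of the walks of length \<open>d\<close>
  from \<open>e\<close> to \<open>g\<close> in the Cayley graph with edges \<open>x \<rightarrow> x s\<close>, \<open>s \<in> S\<close>.\<close>

definition cayley_words :: "('g, 'b) monoid_scheme \<Rightarrow> 'g set \<Rightarrow> 'g \<Rightarrow> nat \<Rightarrow> 'g list set" where
  "cayley_words G S g d = {w. length w = d \<and> set w \<subseteq> S \<and> foldr (\<lambda>x y. x \<otimes>\<^bsub>G\<^esub> y) w \<one>\<^bsub>G\<^esub> = g}"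

definition word_weight :: "('g \<Rightarrow> real) \<Rightarrow> 'g list \<Rightarrow> real" where
  "word_weight \<omega> w = prod_list (map \<omega> w)"

end

theory Submission
  imports Defs "Jordan_Normal_Form.Spectral_Radius"
begin

text \<open>The sum of the weights of the words of length \<open>d\<close> that reduce to \<open>g\<close> is the coefficient of
  \<open>g\<close> in the power \<open>f\<^sup>d\<close> of the group algebra (\<open>word_sum_Suc\<close>). As \<open>Q\<close> is closed under
  multiplication (\<open>Q_alg_mult_closed\<close>) and \<open>\<theta>\<close> is multiplicative on it (\<open>theta_mult\<close>),
  \<open>f\<^sup>d\<close> lies in \<open>Q\<close> and \<open>\<theta>(f\<^sup>d) = (\<chi>\<^sup>V)\<^sup>d\<close> is the character of the \<open>d\<close>-th tensor
  power. The basis elements of \<open>Q\<close> have disjoint supports and coefficients \<open>1\<close>, so the coefficient of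
  \<open>f\<^sup>d\<close> at any \<open>\<sigma>\<^sub>i\<close> in the support of \<open>b\<^sub>i\<close> is the coordinate \<open>c\<^sub>i\<close> of \<open>f\<^sup>d\<close> at \<open>b\<^sub>i\<close>
  (\<open>basis_comb_supp\<close>). Hence the character of the tensor power is the sum of the \<open>c\<^sub>i \<theta>(b\<^sub>i)\<close>.
  Each \<open>\<theta>(b\<^sub>i)\<close> is the character of a simple module (\<open>basis_char_simple\<close>), so taking the inner product
  with \<open>\<chi>\<^sup>\<tau>\<close> leaves the sum of those \<open>c\<^sub>i\<close> for which \<open>\<theta>(b\<^sub>i) = \<chi>\<^sup>\<tau>\<close>; by Maschke's theorem and
  Schur orthogonality that inner product is the multiplicity of \<open>\<tau>\<close> (\<open>multiplicity_char_ip\<close>).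

  The multiplicativity of \<open>\<theta>\<close> comes from eigenvectors. Put \<open>t = rs\<close>, so that
  \<open>y\<^sub>i = r\<^sup>i + r\<^sup>-\<^sup>i t\<close>, and let \<open>\<zeta> = exp (2 \<pi> \<i> / m)\<close>. For an integer \<open>a\<close>
  let \<open>r\<close> act on \<open>v\<^sub>+\<close> and \<open>v\<^sub>-\<close> by \<open>\<zeta>\<^sup>a\<close> and \<open>\<zeta>\<^sup>-\<^sup>a\<close>, and let \<open>t\<close> exchange these two
  vectors. Every \<open>f\<close> in \<open>Q\<close> then has \<open>v\<^sub>+ + v\<^sub>-\<close> as an eigenvector, with eigenvalue
  \<open>\<theta>(f)(r\<^sup>a)\<close>, and the linear form \<open>v\<^sub>+\<^sup>* - v\<^sub>-\<^sup>*\<close> as a left eigenvector, with eigenvalue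
  \<open>\<theta>(f)(r\<^sup>a s)\<close>. Eigenvalues for a common eigenvector multiply.\<close>

section \<open>Subspaces in coordinates\<close>

lemma subspace_iff:
  "subspace class_ring W (module_vec TYPE(complex) n) \<longleftrightarrow>
     W \<subseteq> carrier_vec n \<and> 0\<^sub>v n \<in> W \<and> (\<forall>v\<in>W. \<forall>w\<in>W. v + w \<in> W) \<and> (\<forall>c. \<forall>v\<in>W. c \<cdot>\<^sub>v v \<in> W)"
  (is "?L \<longleftrightarrow> ?R")
proof
  interpret V: vec_space "TYPE(complex)" n .
  assume ?L
  then interpret W: submodule class_ring W "module_vec TYPE(complex) n"
    by (simp add: VectorSpace.subspace_def)
  show ?R
    using W.subset W.zero_closed W.m_closed W.smult_closed by (auto simp: module_vec_simps)
next
  interpret V: vec_space "TYPE(complex)" n .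
  assume R: ?R
  have "submodule class_ring W (module_vec TYPE(complex) n)"
    by (unfold_locales) (use R in \<open>auto simp: module_vec_simps\<close>)
  then show ?L
    using vec_vs by (simp add: VectorSpace.subspace_def)
qed

lemma mat_mult_entry:
  assumes "A \<in> carrier_mat n k" "B \<in> carrier_mat k m" "i < n" "j < m"
  shows "(A * B) $$ (i, j) = (\<Sum>a<k. A $$ (i, a) * B $$ (a, j))"
  using assms by (simp add: scalar_prod_def atLeast0LessThan)

lemma trace_mult_comm:
  fixes A B :: "complex mat"
  assumes "A \<in> carrier_mat n k" "B \<in> carrier_mat k n"
  shows "(\<Sum>i<n. (A * B) $$ (i, i)) = (\<Sum>i<k. (B * A) $$ (i, i))"
proof -
  have "(\<Sum>i<n. (A * B) $$ (i, i)) = (\<Sum>i<n. \<Sum>j<k. A $$ (i, j) * B $$ (j, i))"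
    using assms by (intro sum.cong) (auto simp: scalar_prod_def atLeast0LessThan)
  also have "\<dots> = (\<Sum>j<k. \<Sum>i<n. B $$ (j, i) * A $$ (i, j))"
    by (subst sum.swap) (simp add: mult.commute)
  also have "\<dots> = (\<Sum>i<k. (B * A) $$ (i, i))"
    using assms by (intro sum.cong) (auto simp: scalar_prod_def atLeast0LessThan)
  finally show ?thesis .
qed

text \<open>The elementary step of the exchange argument for bases.\<close>

lemma replace_column_invertible:
  fixes x :: "nat \<Rightarrow> complex"
  assumes k: "k < n" and xk: "x k \<noteq> 0"
  defines "M \<equiv> mat n n (\<lambda>(a, b). if b = k then x a else if a = b then 1 else 0)"
    and "N \<equiv> mat n n (\<lambda>(a, b). if b = k then (if a = k then 1 / x k else - x a / x k) else if a = b then 1 else 0)"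
  shows "M * N = 1\<^sub>m n" "N * M = 1\<^sub>m n"
proof -
  have car: "M \<in> carrier_mat n n" "N \<in> carrier_mat n n" by (simp_all add: M_def N_def)
  show MN: "M * N = 1\<^sub>m n"
  proof (rule eq_matI)
    fix a b assume "a < dim_row (1\<^sub>m n)" "b < dim_col (1\<^sub>m n)"
    then have ab: "a < n" "b < n" by auto
    have "(M * N) $$ (a, b) = (\<Sum>j<n. M $$ (a, j) * N $$ (j, b))"
      using ab car by (simp add: scalar_prod_def atLeast0LessThan)
    also have "\<dots> = (\<Sum>j<n. (if j = k then x a * N $$ (k, b) else 0)
                        + (if j = a then (if a = k then 0 else N $$ (a, b)) else 0))"
      by (rule sum.cong) (use ab k in \<open>auto simp: M_def\<close>)
    also have "\<dots> = x a * N $$ (k, b) + (if a = k then 0 else N $$ (a, b))"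
      using ab k by (simp add: sum.distrib)
    also have "\<dots> = 1\<^sub>m n $$ (a, b)"
      using ab k xk by (auto simp: N_def)
    finally show "(M * N) $$ (a, b) = 1\<^sub>m n $$ (a, b)" .
  qed (use car in auto)
  show "N * M = 1\<^sub>m n" by (rule mat_mult_left_right_inverse[OF car MN])
qed

lemma col_as_mult_unit_vec:
  assumes "(A :: complex mat) \<in> carrier_mat m n" "j < n"
  shows "A *\<^sub>v unit_vec n j = col A j"
  using assms by (intro eq_vecI) auto

text \<open>Every subspace of \<open>\<complex>\<^sup>n\<close> becomes, in a suitable basis, the span of the first \<open>k\<close> basis vectors.
  The columns of \<open>P\<close> are chosen with as many initial columns in \<open>W\<close> as possible; a vector of \<open>W\<close>
  with a nonzero later coordinate could be exchanged for a later column.\<close>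

lemma subspace_adapted_basis:
  assumes W: "subspace class_ring W (module_vec TYPE(complex) n)"
  obtains k P Q where "k \<le> n" "P \<in> carrier_mat n n" "Q \<in> carrier_mat n n"
    "P * Q = 1\<^sub>m n" "Q * P = 1\<^sub>m n"
    "\<And>v. v \<in> carrier_vec n \<Longrightarrow> v \<in> W \<longleftrightarrow> (\<forall>i. k \<le> i \<and> i < n \<longrightarrow> (Q *\<^sub>v v) $ i = 0)"
proof -
  note W' = W[unfolded subspace_iff]
  have sub: "W \<subseteq> carrier_vec n" and z: "0\<^sub>v n \<in> W"
    and add: "\<And>v w. v \<in> W \<Longrightarrow> w \<in> W \<Longrightarrow> v + w \<in> W" and sm: "\<And>c v. v \<in> W \<Longrightarrow> c \<cdot>\<^sub>v v \<in> W"
    using W' by blast+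
  define good where "good k P Q \<longleftrightarrow> k \<le> n \<and> P \<in> carrier_mat n n \<and> Q \<in> carrier_mat n n \<and>
    P * Q = 1\<^sub>m n \<and> Q * P = 1\<^sub>m n \<and> (\<forall>j<k. col P j \<in> W)" for k P Q
  have "good 0 (1\<^sub>m n) (1\<^sub>m n)" by (simp add: good_def)
  then have ex0: "\<exists>P Q. good 0 P Q" by blast
  have "\<forall>k. (\<exists>P Q. good k P Q) \<longrightarrow> k < Suc n" by (auto simp: good_def)
  from ex_has_greatest_nat[where P = "\<lambda>k. \<exists>P Q. good k P Q" and f = "\<lambda>k. k", OF ex0 this]
  obtain k where k: "\<exists>P Q. good k P Q" and "\<And>l. \<exists>P Q. good l P Q \<Longrightarrow> l \<le> k" by blast
  then have mx: "\<not> good (Suc k) P' Q'" for P' Q' using not_less_eq_eq by blast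
  from k obtain P Q where g: "good k P Q" by blast
  from g have kn: "k \<le> n" and P: "P \<in> carrier_mat n n" and Q: "Q \<in> carrier_mat n n"
    and PQ: "P * Q = 1\<^sub>m n" and QP: "Q * P = 1\<^sub>m n" and colW: "\<And>j. j < k \<Longrightarrow> col P j \<in> W"
    by (auto simp: good_def)
  have fwd: "(Q *\<^sub>v w) $ i = 0" if w: "w \<in> W" and i: "k \<le> i" "i < n" for w i
  proof (rule ccontr)
    assume nz: "(Q *\<^sub>v w) $ i \<noteq> 0"
    have wc: "w \<in> carrier_vec n" using w sub by blast
    \<comment> \<open>After exchanging the basis vectors \<open>i\<close> and \<open>k\<close>, the vector \<open>w\<close> can replace the \<open>k\<close>-th one.\<close>
    define t where "t = Transposition.transpose k i"
    have tt: "t (t a) = a" "a < n \<Longrightarrow> t a < n" "a < k \<Longrightarrow> t a = a" for a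
      using i kn by (auto simp: t_def Transposition.transpose_def)
    define P1 where "P1 = mat n n (\<lambda>(a, b). P $$ (a, t b))"
    define Q1 where "Q1 = mat n n (\<lambda>(a, b). Q $$ (t a, b))"
    have car1: "P1 \<in> carrier_mat n n" "Q1 \<in> carrier_mat n n" by (simp_all add: P1_def Q1_def)
    have PQ1: "P1 * Q1 = 1\<^sub>m n"
    proof (rule eq_matI)
      fix a b assume "a < dim_row (1\<^sub>m n)" "b < dim_col (1\<^sub>m n)"
      then have ab: "a < n" "b < n" by auto
      have "(P1 * Q1) $$ (a, b) = (\<Sum>j<n. P $$ (a, t j) * Q $$ (t j, b))"
        using ab by (simp add: P1_def Q1_def scalar_prod_def atLeast0LessThan)
      also have "\<dots> = (\<Sum>j<n. P $$ (a, j) * Q $$ (j, b))"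
        by (rule sum.reindex_bij_witness[of _ t t]) (use tt in auto)
      also have "\<dots> = (P * Q) $$ (a, b)"
        using ab P Q by (simp add: scalar_prod_def atLeast0LessThan)
      finally show "(P1 * Q1) $$ (a, b) = 1\<^sub>m n $$ (a, b)" unfolding PQ .
    qed (use car1 in auto)
    have QP1: "Q1 * P1 = 1\<^sub>m n" by (rule mat_mult_left_right_inverse[OF car1 PQ1])
    define x where "x a = (Q1 *\<^sub>v w) $ a" for a
    have "row Q1 k = row Q i"
      using i Q by (intro eq_vecI) (auto simp: Q1_def t_def)
    then have xk: "x k \<noteq> 0" using nz i Q car1 by (auto simp: x_def)
    have kn': "k < n" using i by simp
    define M where "M = mat n n (\<lambda>(a, b). if b = k then x a else if a = b then 1 else 0)"
    define N where "N = mat n n (\<lambda>(a, b). if b = k then (if a = k then 1 / x k else - x a / x k) else if a = b then 1 else 0)"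
    have MN: "M * N = 1\<^sub>m n" "N * M = 1\<^sub>m n"
      unfolding M_def N_def using replace_column_invertible[where n = n and x = x, OF kn' xk] by auto
    have carM: "M \<in> carrier_mat n n" "N \<in> carrier_mat n n" by (simp_all add: M_def N_def)
    have "good (Suc k) (P1 * M) (N * Q1)"
      unfolding good_def
    proof (intro conjI allI impI)
      show "Suc k \<le> n" using kn' by simp
      show "P1 * M \<in> carrier_mat n n" "N * Q1 \<in> carrier_mat n n" using car1 carM by auto
      have "(P1 * M) * (N * Q1) = P1 * ((M * N) * Q1)"
        using car1 carM by (simp add: assoc_mult_mat[of _ n n _ n _ n])
      also have "\<dots> = 1\<^sub>m n" using MN car1 PQ1 by simp
      finally show "(P1 * M) * (N * Q1) = 1\<^sub>m n" .
      have "(N * Q1) * (P1 * M) = N * ((Q1 * P1) * M)"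
        using car1 carM by (simp add: assoc_mult_mat[of _ n n _ n _ n])
      also have "\<dots> = 1\<^sub>m n" using MN carM QP1 by simp
      finally show "(N * Q1) * (P1 * M) = 1\<^sub>m n" .
    next
      fix j assume "j < Suc k"
      then consider "j = k" | "j < k" by linarith
      then show "col (P1 * M) j \<in> W"
      proof cases
        case 1
        have "col M k = Q1 *\<^sub>v w"
          using kn' car1 by (intro eq_vecI) (auto simp: M_def x_def)
        then have "col (P1 * M) k = P1 *\<^sub>v (Q1 *\<^sub>v w)"
          using car1 carM kn' by (simp add: col_mult2[of _ n n _ n] del: col_mult)
        also have "\<dots> = w"
          using assoc_mult_mat_vec[OF car1 wc] PQ1 wc by simp
        finally show ?thesis using 1 w by simp
      next
        case 2
        then have "col M j = unit_vec n j"
          using kn' by (intro eq_vecI) (auto simp: M_def)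
        then have "col (P1 * M) j = col P1 j"
          using car1 carM kn' 2 by (simp add: col_mult2[of _ n n _ n] col_as_mult_unit_vec[of _ n n] del: col_mult)
        also have "\<dots> = col P j"
          using 2 kn' P by (intro eq_vecI) (auto simp: P1_def tt)
        finally show ?thesis using colW[OF 2] by simp
      qed
    qed
    then show False using mx by blast
  qed
  have bwd: "v \<in> W" if v: "v \<in> carrier_vec n" and zero: "\<And>i. k \<le> i \<Longrightarrow> i < n \<Longrightarrow> (Q *\<^sub>v v) $ i = 0" for v
  proof -
    define x where "x j = (Q *\<^sub>v v) $ j" for j
    define c where "c t = vec n (\<lambda>j. if j < t then x j else 0)" for t
    have carc: "c t \<in> carrier_vec n" for t by (simp add: c_def)
    have "P *\<^sub>v c t \<in> W" if "t \<le> k" for t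
      using that
    proof (induction t)
      case 0
      have "c 0 = 0\<^sub>v n" by (intro eq_vecI) (auto simp: c_def)
      moreover have "P *\<^sub>v 0\<^sub>v n = 0\<^sub>v n" using P by (intro eq_vecI) auto
      ultimately show ?case using z by simp
    next
      case (Suc t)
      have "c (Suc t) = c t + x t \<cdot>\<^sub>v unit_vec n t"
        by (intro eq_vecI) (auto simp: c_def less_Suc_eq unit_vec_def)
      then have "P *\<^sub>v c (Suc t) = P *\<^sub>v c t + x t \<cdot>\<^sub>v (P *\<^sub>v unit_vec n t)"
        using P carc by (simp add: mult_add_distrib_mat_vec[of _ n n] mult_mat_vec[of _ n n])
      also have "P *\<^sub>v unit_vec n t = col P t"
        using Suc.prems kn by (intro col_as_mult_unit_vec[OF P]) simp
      finally show ?case using Suc add sm colW[of t] by simp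
    qed
    then have "P *\<^sub>v c k \<in> W" by simp
    moreover have "c k = Q *\<^sub>v v"
      using zero Q by (intro eq_vecI) (auto simp: c_def x_def not_less)
    moreover have "P *\<^sub>v (Q *\<^sub>v v) = v"
      using assoc_mult_mat_vec[OF P Q v] PQ v by simp
    ultimately show ?thesis by simp
  qed
  show thesis
    by (rule that[OF kn P Q PQ QP]) (use fwd bwd in blast)
qed

section \<open>Sums of matrices, isomorphism and characters\<close>

definition mat_sum :: "nat \<Rightarrow> nat \<Rightarrow> ('a \<Rightarrow> complex mat) \<Rightarrow> 'a set \<Rightarrow> complex mat" where
  "mat_sum r c F A = mat r c (\<lambda>(i, j). \<Sum>a\<in>A. F a $$ (i, j))"

lemma mat_sum_carrier [simp]: "mat_sum r c F A \<in> carrier_mat r c"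
  by (simp add: mat_sum_def)

lemma mat_sum_cong:
  "(\<And>a. a \<in> A \<Longrightarrow> F a = H a) \<Longrightarrow> mat_sum r c F A = mat_sum r c H A"
  by (simp add: mat_sum_def cong: sum.cong)

lemma mat_sum_reindex:
  assumes "bij_betw h A A"
  shows "mat_sum r c (\<lambda>a. F (h a)) A = mat_sum r c F A"
  unfolding mat_sum_def using assms
  by (intro cong_mat) (auto simp: sum.reindex_bij_betw[of h A A "\<lambda>a. F a $$ _"])

lemma mult_mat_sum:
  assumes "M \<in> carrier_mat q r" "\<And>a. a \<in> A \<Longrightarrow> F a \<in> carrier_mat r c"
  shows "M * mat_sum r c F A = mat_sum q c (\<lambda>a. M * F a) A"
proof (rule eq_matI)
  fix i j assume "i < dim_row (mat_sum q c (\<lambda>a. M * F a) A)" "j < dim_col (mat_sum q c (\<lambda>a. M * F a) A)"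
  then have ij: "i < q" "j < c" by (simp_all add: mat_sum_def)
  have "(M * mat_sum r c F A) $$ (i, j) = (\<Sum>l<r. \<Sum>a\<in>A. M $$ (i, l) * F a $$ (l, j))"
    using assms ij by (simp add: scalar_prod_def mat_sum_def atLeast0LessThan sum_distrib_left)
  also have "\<dots> = (\<Sum>a\<in>A. \<Sum>l<r. M $$ (i, l) * F a $$ (l, j))" by (rule sum.swap)
  also have "\<dots> = (\<Sum>a\<in>A. (M * F a) $$ (i, j))"
    using assms ij by (intro sum.cong) (auto simp: scalar_prod_def atLeast0LessThan dest!: assms(2))
  finally show "(M * mat_sum r c F A) $$ (i, j) = mat_sum q c (\<lambda>a. M * F a) A $$ (i, j)"
    using ij by (simp add: mat_sum_def)
qed (use assms in \<open>auto simp: mat_sum_def\<close>)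

lemma mat_sum_mult:
  assumes "M \<in> carrier_mat c q" "\<And>a. a \<in> A \<Longrightarrow> F a \<in> carrier_mat r c"
  shows "mat_sum r c F A * M = mat_sum r q (\<lambda>a. F a * M) A"
proof (rule eq_matI)
  fix i j assume "i < dim_row (mat_sum r q (\<lambda>a. F a * M) A)" "j < dim_col (mat_sum r q (\<lambda>a. F a * M) A)"
  then have ij: "i < r" "j < q" by (simp_all add: mat_sum_def)
  have "(mat_sum r c F A * M) $$ (i, j) = (\<Sum>l<c. \<Sum>a\<in>A. F a $$ (i, l) * M $$ (l, j))"
    using assms ij by (simp add: scalar_prod_def mat_sum_def atLeast0LessThan sum_distrib_right)
  also have "\<dots> = (\<Sum>a\<in>A. \<Sum>l<c. F a $$ (i, l) * M $$ (l, j))" by (rule sum.swap)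
  also have "\<dots> = (\<Sum>a\<in>A. (F a * M) $$ (i, j))"
    using assms ij by (intro sum.cong) (auto simp: scalar_prod_def atLeast0LessThan dest!: assms(2))
  finally show "(mat_sum r c F A * M) $$ (i, j) = mat_sum r q (\<lambda>a. F a * M) A $$ (i, j)"
    using ij by (simp add: mat_sum_def)
qed (use assms in \<open>auto simp: mat_sum_def\<close>)

lemma iso_rep_sym: "iso_rep G \<rho> \<tau> \<Longrightarrow> iso_rep G \<tau> \<rho>"
  unfolding iso_rep_def using similar_mat_wit_sym by blast

lemma iso_rep_trans: "iso_rep G \<rho> \<sigma> \<Longrightarrow> iso_rep G \<sigma> \<tau> \<Longrightarrow> iso_rep G \<rho> \<tau>"
  unfolding iso_rep_def using similar_mat_wit_trans by metis

lemma iso_rep_refl: "mat_rep G n \<rho> \<Longrightarrow> iso_rep G \<rho> \<rho>"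
  unfolding iso_rep_def mat_rep_def using similar_mat_wit_refl by blast

lemma rep_char_iso:
  assumes iso: "iso_rep G \<rho> \<tau>" and g: "g \<in> carrier G"
  shows "rep_char \<rho> g = rep_char \<tau> g"
proof -
  obtain P Q where sim: "similar_mat_wit (\<rho> g) (\<tau> g) P Q"
    using iso g by (auto simp: iso_rep_def)
  define n where "n = dim_row (\<rho> g)"
  note s = similar_mat_witD[OF n_def sim]
  have "rep_char \<rho> g = (\<Sum>i<n. ((P * \<tau> g) * Q) $$ (i, i))"
    using s(3) by (simp add: rep_char_def n_def)
  also have "\<dots> = (\<Sum>i<n. (Q * (P * \<tau> g)) $$ (i, i))"
    using s by (intro trace_mult_comm) auto
  also have "Q * (P * \<tau> g) = \<tau> g"
    using s assoc_mult_mat[of Q n n P n "\<tau> g" n] by simp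
  finally show ?thesis using s by (simp add: rep_char_def)
qed

lemma rep_char_direct_sum:
  assumes "\<And>\<rho>. \<rho> \<in> set \<rho>s \<Longrightarrow> dim_col (\<rho> g) = dim_row (\<rho> g)"
  shows "rep_char (direct_sum_rep \<rho>s) g = (\<Sum>\<rho>\<leftarrow>\<rho>s. rep_char \<rho> g)"
  using assms
proof (induction \<rho>s)
  case (Cons \<rho> \<rho>s)
  define D where "D = diag_block_mat (map (\<lambda>\<rho>. \<rho> g) \<rho>s)"
  define a b where "a = dim_row (\<rho> g)" and "b = dim_row D"
  have A: "\<rho> g \<in> carrier_mat a a" by (rule carrier_matI) (simp_all add: a_def Cons.prems)
  have "square_mat D" unfolding D_def
    by (rule diag_block_mat_square) (use Cons.prems in auto)
  then have D: "D \<in> carrier_mat b b" by (intro carrier_matI) (simp_all add: b_def)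
  have "rep_char (direct_sum_rep (\<rho> # \<rho>s)) g = (\<Sum>i<a + b. four_block_mat (\<rho> g) (0\<^sub>m a b) (0\<^sub>m b a) D $$ (i, i))"
    using A D unfolding rep_char_def direct_sum_rep_def list.map diag_block_mat.simps Let_def D_def[symmetric]
    by (simp add: four_block_mat_def)
  also have "\<dots> = (\<Sum>i<a. \<rho> g $$ (i, i)) + (\<Sum>i<b. D $$ (i, i))"
  proof -
    have "(\<Sum>i<a + b. four_block_mat (\<rho> g) (0\<^sub>m a b) (0\<^sub>m b a) D $$ (i, i))
        = (\<Sum>i<a + b. if i < a then \<rho> g $$ (i, i) else D $$ (i - a, i - a))"
      by (rule sum.cong) (use A D in auto)
    also have "\<dots> = (\<Sum>i<a. \<rho> g $$ (i, i)) + (\<Sum>i<b. D $$ (i, i))"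
      by (induction b) (auto simp: algebra_simps)
    finally show ?thesis .
  qed
  also have "\<dots> = rep_char \<rho> g + rep_char (direct_sum_rep \<rho>s) g"
    by (simp add: rep_char_def direct_sum_rep_def a_def b_def D_def)
  finally show ?case using Cons by simp
qed (simp add: rep_char_def direct_sum_rep_def)

lemma iso_rep_block_diag:
  assumes "iso_rep G \<rho> (direct_sum_rep \<rho>s)" "iso_rep G \<sigma> (direct_sum_rep \<sigma>s)"
    and "mat_rep G a \<rho>" "mat_rep G b \<sigma>"
  shows "iso_rep G (\<lambda>g. four_block_mat (\<rho> g) (0\<^sub>m a b) (0\<^sub>m b a) (\<sigma> g)) (direct_sum_rep (\<rho>s @ \<sigma>s))"
proof -
  obtain P Q P' Q' where
    1: "\<And>g. g \<in> carrier G \<Longrightarrow> similar_mat_wit (\<rho> g) (direct_sum_rep \<rho>s g) P Q" and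
    2: "\<And>g. g \<in> carrier G \<Longrightarrow> similar_mat_wit (\<sigma> g) (direct_sum_rep \<sigma>s g) P' Q'"
    using assms unfolding iso_rep_def by blast
  have "similar_mat_wit (four_block_mat (\<rho> g) (0\<^sub>m a b) (0\<^sub>m b a) (\<sigma> g)) (direct_sum_rep (\<rho>s @ \<sigma>s) g)
     (four_block_mat P (0\<^sub>m a b) (0\<^sub>m b a) P') (four_block_mat Q (0\<^sub>m a b) (0\<^sub>m b a) Q')"
    if g: "g \<in> carrier G" for g
  proof -
    have car: "\<rho> g \<in> carrier_mat a a" "\<sigma> g \<in> carrier_mat b b"
      using assms g by (auto simp: mat_rep_def)
    note s1 = similar_mat_witD2[OF car(1) 1[OF g]] and s2 = similar_mat_witD2[OF car(2) 2[OF g]]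
    have "direct_sum_rep (\<rho>s @ \<sigma>s) g =
        four_block_mat (direct_sum_rep \<rho>s g) (0\<^sub>m a b) (0\<^sub>m b a) (direct_sum_rep \<sigma>s g)"
      using s1(5) s2(5) by (simp add: direct_sum_rep_def diag_block_mat_append Let_def)
    then show ?thesis
      using similar_mat_wit_four_block[OF 1[OF g] 2[OF g] _ _ car, of "0\<^sub>m a b" "0\<^sub>m a b" "0\<^sub>m b a" "0\<^sub>m b a"]
        s1 s2 by simp
  qed
  then show ?thesis unfolding iso_rep_def by blast
qed

lemma four_block_mat_inject:
  assumes "A \<in> carrier_mat k k" "B \<in> carrier_mat k m" "C \<in> carrier_mat m k" "D \<in> carrier_mat m m"
    and "A' \<in> carrier_mat k k" "B' \<in> carrier_mat k m" "C' \<in> carrier_mat m k" "D' \<in> carrier_mat m m"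
    and eq: "four_block_mat A B C D = four_block_mat A' B' C' D'"
  shows "A = A' \<and> B = B' \<and> D = D'"
proof (intro conjI)
  note e = arg_cong[OF eq, of "\<lambda>M. M $$ _"]
  show "A = A'"
  proof (rule eq_matI)
    fix i j assume "i < dim_row A'" "j < dim_col A'"
    then show "A $$ (i, j) = A' $$ (i, j)" using e[of "(i, j)"] assms(1-8) by auto
  qed (use assms in auto)
  show "B = B'"
  proof (rule eq_matI)
    fix i j assume "i < dim_row B'" "j < dim_col B'"
    then show "B $$ (i, j) = B' $$ (i, j)" using e[of "(i, j + k)"] assms(1-8) by auto
  qed (use assms in auto)
  show "D = D'"
  proof (rule eq_matI)
    fix i j assume "i < dim_row D'" "j < dim_col D'"
    then show "D $$ (i, j) = D' $$ (i, j)" using e[of "(i + k, j + k)"] assms(1-8) by auto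
  qed (use assms in auto)
qed

section \<open>Schur orthogonality\<close>

locale finite_group = Group.group G for G (structure) +
  assumes finite_carrier [simp]: "finite (carrier G)"
begin

lemma card_pos: "card (carrier G) > 0"
  using one_closed by (auto simp: card_gt_0_iff)

lemma of_nat_card_nonzero: "complex_of_nat (card (carrier G)) \<noteq> 0"
  using card_pos by (metis less_irrefl of_nat_eq_0_iff)

lemma bij_mult_left: "h \<in> carrier G \<Longrightarrow> bij_betw (\<lambda>g. h \<otimes> g) (carrier G) (carrier G)"
  by (rule bij_betw_byWitness[where f' = "\<lambda>g. inv h \<otimes> g"]) (auto simp: m_assoc[symmetric])

lemma mat_repD:
  assumes "mat_rep G n \<rho>"
  shows "g \<in> carrier G \<Longrightarrow> \<rho> g \<in> carrier_mat n n" "\<rho> \<one> = 1\<^sub>m n"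
    "g \<in> carrier G \<Longrightarrow> h \<in> carrier G \<Longrightarrow> \<rho> (g \<otimes> h) = \<rho> g * \<rho> h"
    "g \<in> carrier G \<Longrightarrow> \<rho> g * \<rho> (inv g) = 1\<^sub>m n" "g \<in> carrier G \<Longrightarrow> \<rho> (inv g) * \<rho> g = 1\<^sub>m n"
proof -
  show "g \<in> carrier G \<Longrightarrow> \<rho> g \<in> carrier_mat n n" "\<rho> \<one> = 1\<^sub>m n"
    and h: "\<And>g h. g \<in> carrier G \<Longrightarrow> h \<in> carrier G \<Longrightarrow> \<rho> (g \<otimes> h) = \<rho> g * \<rho> h"
    using assms by (auto simp: mat_rep_def)
  show "g \<in> carrier G \<Longrightarrow> \<rho> g * \<rho> (inv g) = 1\<^sub>m n" "g \<in> carrier G \<Longrightarrow> \<rho> (inv g) * \<rho> g = 1\<^sub>m n"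
    using h[of g "inv g"] h[of "inv g" g] assms by (auto simp: mat_rep_def)
qed

text \<open>Averaging over the group turns an arbitrary matrix into a homomorphism of modules.\<close>

lemma average_intertwines:
  assumes \<sigma>: "mat_rep G n \<sigma>" and \<tau>: "mat_rep G p \<tau>" and Y: "Y \<in> carrier_mat n p" and h: "h \<in> carrier G"
  defines "S \<equiv> mat_sum n p (\<lambda>g. \<sigma> g * Y * \<tau> (inv g)) (carrier G)"
  shows "\<sigma> h * S = S * \<tau> h"
proof -
  note \<sigma>s = mat_repD[OF \<sigma>] and \<tau>s = mat_repD[OF \<tau>]
  have car: "\<sigma> g * Y * \<tau> (inv g) \<in> carrier_mat n p" if "g \<in> carrier G" for g
    using \<sigma>s(1)[OF that] \<tau>s(1)[of "inv g"] that Y by auto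
  have "\<sigma> h * S = mat_sum n p (\<lambda>g. \<sigma> h * (\<sigma> g * Y * \<tau> (inv g))) (carrier G)"
    unfolding S_def by (rule mult_mat_sum[OF \<sigma>s(1)[OF h]]) (rule car)
  also have "\<dots> = mat_sum n p (\<lambda>g. \<sigma> (h \<otimes> g) * Y * \<tau> (inv (h \<otimes> g)) * \<tau> h) (carrier G)"
  proof (rule mat_sum_cong)
    fix g assume g: "g \<in> carrier G"
    have "\<tau> (inv g) = \<tau> (inv (h \<otimes> g)) * \<tau> h"
      using h g by (simp add: \<tau>s(3)[symmetric] inv_mult_group m_assoc)
    then have "\<sigma> (h \<otimes> g) * Y * \<tau> (inv (h \<otimes> g)) * \<tau> h = (\<sigma> h * \<sigma> g) * Y * \<tau> (inv g)"
      using h g \<sigma>s(1)[of h] \<sigma>s(1)[of g] \<tau>s(1)[of h] \<tau>s(1)[of "inv (h \<otimes> g)"] Y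
      by (simp add: \<sigma>s(3) assoc_mult_mat[of _ n n _ p _ p] assoc_mult_mat[of _ n p _ p _ p]
            assoc_mult_mat[of _ n n _ n _ p])
    also have "\<dots> = \<sigma> h * (\<sigma> g * Y * \<tau> (inv g))"
      using h g \<sigma>s(1)[of h] \<sigma>s(1)[of g] \<tau>s(1)[of "inv g"] Y
      by (simp add: assoc_mult_mat[of _ n n _ p _ p] assoc_mult_mat[of _ n p _ p _ p]
            assoc_mult_mat[of _ n n _ n _ p])
    finally show "\<sigma> h * (\<sigma> g * Y * \<tau> (inv g)) = \<sigma> (h \<otimes> g) * Y * \<tau> (inv (h \<otimes> g)) * \<tau> h" ..
  qed
  also have "\<dots> = mat_sum n p (\<lambda>g. \<sigma> g * Y * \<tau> (inv g) * \<tau> h) (carrier G)"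
    using mat_sum_reindex[OF bij_mult_left[OF h], of n p "\<lambda>g. \<sigma> g * Y * \<tau> (inv g) * \<tau> h"] by simp
  also have "\<dots> = S * \<tau> h"
    unfolding S_def by (rule mat_sum_mult[OF \<tau>s(1)[OF h] car, symmetric])
  finally show ?thesis .
qed

text \<open>The first half of Schur's lemma. The kernel and the image of \<open>T\<close> are submodules, so \<open>T\<close> is
  bijective; comparing the traces of \<open>T Q\<close> and \<open>Q T\<close> shows that the dimensions agree.\<close>

lemma schur_invertible:
  assumes \<sigma>: "simple_rep G n \<sigma>" and \<tau>: "simple_rep G p \<tau>" and T: "T \<in> carrier_mat n p"
    and comm: "\<And>g. g \<in> carrier G \<Longrightarrow> \<sigma> g * T = T * \<tau> g" and nz: "T \<noteq> 0\<^sub>m n p"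
  obtains Q where "Q \<in> carrier_mat p n" "T * Q = 1\<^sub>m n" "Q * T = 1\<^sub>m p" "n = p"
proof -
  have rs: "mat_rep G n \<sigma>" "mat_rep G p \<tau>" using \<sigma> \<tau> by (auto simp: simple_rep_def)
  note \<sigma>s = mat_repD[OF rs(1)] and \<tau>s = mat_repD[OF rs(2)]
  have zero: "T *\<^sub>v 0\<^sub>v p = 0\<^sub>v n" using T by (intro eq_vecI) auto
  have "submodule_of G p \<tau> {v \<in> carrier_vec p. T *\<^sub>v v = 0\<^sub>v n}"
    unfolding submodule_of_def subspace_iff
  proof (intro conjI ballI allI)
    fix g w assume g: "g \<in> carrier G" and w: "w \<in> {v \<in> carrier_vec p. T *\<^sub>v v = 0\<^sub>v n}"
    have "T *\<^sub>v (\<tau> g *\<^sub>v w) = (T * \<tau> g) *\<^sub>v w" using T \<tau>s(1)[OF g] w by simp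
    also have "\<dots> = \<sigma> g *\<^sub>v (T *\<^sub>v w)"
      unfolding comm[OF g, symmetric] using T \<sigma>s(1)[OF g] w by simp
    also have "\<dots> = 0\<^sub>v n" using w \<sigma>s(1)[OF g] by (intro eq_vecI) auto
    finally show "\<tau> g *\<^sub>v w \<in> {v \<in> carrier_vec p. T *\<^sub>v v = 0\<^sub>v n}"
      using \<tau>s(1)[OF g] w by auto
  qed (use T zero in \<open>auto simp: mult_add_distrib_mat_vec[of _ n p] mult_mat_vec[of _ n p]\<close>)
  moreover have "{v \<in> carrier_vec p. T *\<^sub>v v = 0\<^sub>v n} \<noteq> carrier_vec p"
  proof
    assume all: "{v \<in> carrier_vec p. T *\<^sub>v v = 0\<^sub>v n} = carrier_vec p"
    have "T = 0\<^sub>m n p"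
    proof (rule eq_matI)
      fix i j assume "i < dim_row (0\<^sub>m n p)" "j < dim_col (0\<^sub>m n p)"
      then have ij: "i < n" "j < p" by auto
      have "unit_vec p j \<in> {v \<in> carrier_vec p. T *\<^sub>v v = 0\<^sub>v n}" unfolding all by simp
      then have "T *\<^sub>v unit_vec p j = 0\<^sub>v n" by simp
      then have "col T j $ i = 0" using col_as_mult_unit_vec[OF T ij(2)] ij by simp
      then show "T $$ (i, j) = 0\<^sub>m n p $$ (i, j)" using T ij by simp
    qed (use T in auto)
    then show False using nz by simp
  qed
  ultimately have ker: "v = 0\<^sub>v p" if "v \<in> carrier_vec p" "T *\<^sub>v v = 0\<^sub>v n" for v
    using \<tau> that unfolding simple_rep_def by blast
  have "submodule_of G n \<sigma> ((\<lambda>v. T *\<^sub>v v) ` carrier_vec p)"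
    unfolding submodule_of_def subspace_iff
  proof (intro conjI ballI allI)
    show "0\<^sub>v n \<in> (\<lambda>v. T *\<^sub>v v) ` carrier_vec p" using zero by (metis image_eqI zero_carrier_vec)
    fix v w assume "v \<in> (\<lambda>v. T *\<^sub>v v) ` carrier_vec p" "w \<in> (\<lambda>v. T *\<^sub>v v) ` carrier_vec p"
    then obtain v' w' where "v = T *\<^sub>v v'" "w = T *\<^sub>v w'" "v' \<in> carrier_vec p" "w' \<in> carrier_vec p" by blast
    then show "v + w \<in> (\<lambda>v. T *\<^sub>v v) ` carrier_vec p"
      using T by (intro image_eqI[of _ _ "v' + w'"]) (auto simp: mult_add_distrib_mat_vec[of _ n p])
  next
    fix c v assume "v \<in> (\<lambda>v. T *\<^sub>v v) ` carrier_vec p"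
    then obtain v' where "v = T *\<^sub>v v'" "v' \<in> carrier_vec p" by blast
    then show "c \<cdot>\<^sub>v v \<in> (\<lambda>v. T *\<^sub>v v) ` carrier_vec p"
      using T by (intro image_eqI[of _ _ "c \<cdot>\<^sub>v v'"]) (auto simp: mult_mat_vec[of _ n p])
  next
    fix g v assume g: "g \<in> carrier G" and "v \<in> (\<lambda>v. T *\<^sub>v v) ` carrier_vec p"
    then obtain v' where v': "v = T *\<^sub>v v'" "v' \<in> carrier_vec p" by blast
    have "\<sigma> g *\<^sub>v v = (\<sigma> g * T) *\<^sub>v v'" using v' \<sigma>s(1)[OF g] T by simp
    also have "\<dots> = T *\<^sub>v (\<tau> g *\<^sub>v v')" unfolding comm[OF g] using v' \<tau>s(1)[OF g] T by simp
    finally show "\<sigma> g *\<^sub>v v \<in> (\<lambda>v. T *\<^sub>v v) ` carrier_vec p"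
      using v' \<tau>s(1)[OF g] by (intro image_eqI[of _ _ "\<tau> g *\<^sub>v v'"]) auto
  qed (use T in auto)
  moreover have "(\<lambda>v. T *\<^sub>v v) ` carrier_vec p \<noteq> {0\<^sub>v n}"
  proof
    assume "(\<lambda>v. T *\<^sub>v v) ` carrier_vec p = {0\<^sub>v n}"
    moreover have "T *\<^sub>v unit_vec p 0 \<in> (\<lambda>v. T *\<^sub>v v) ` carrier_vec p" by simp
    ultimately have "unit_vec p 0 = (0\<^sub>v p :: complex vec)" by (intro ker) auto
    then have "unit_vec p 0 $ 0 = (0\<^sub>v p $ 0 :: complex)" by simp
    then show False using \<tau> by (simp add: simple_rep_def)
  qed
  ultimately have im: "(\<lambda>v. T *\<^sub>v v) ` carrier_vec p = carrier_vec n"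
    using \<sigma> unfolding simple_rep_def by blast
  have "\<exists>q. q \<in> carrier_vec p \<and> T *\<^sub>v q = unit_vec n j" for j
    using im unit_vec_carrier[of n j] by (metis imageE)
  then obtain q where q: "\<And>j. q j \<in> carrier_vec p" "\<And>j. T *\<^sub>v q j = unit_vec n j" by metis
  define Q where "Q = mat p n (\<lambda>(i, j). q j $ i)"
  have Q: "Q \<in> carrier_mat p n" by (simp add: Q_def)
  have colQ: "col Q j = q j" if "j < n" for j
    using that q(1)[of j] by (intro eq_vecI) (auto simp: Q_def)
  have TQ: "T * Q = 1\<^sub>m n"
  proof (rule eq_matI)
    fix i j assume "i < dim_row (1\<^sub>m n)" "j < dim_col (1\<^sub>m n)"
    then have ij: "i < n" "j < n" by auto
    have "(T * Q) $$ (i, j) = (T *\<^sub>v col Q j) $ i" using ij T Q by simp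
    then show "(T * Q) $$ (i, j) = 1\<^sub>m n $$ (i, j)" using ij colQ q(2) by simp
  qed (use T Q in auto)
  have QT: "Q * T = 1\<^sub>m p"
  proof (rule eq_matI)
    fix i j assume "i < dim_row (1\<^sub>m p)" "j < dim_col (1\<^sub>m p)"
    then have ij: "i < p" "j < p" by auto
    define u where "u = (Q * T) *\<^sub>v unit_vec p j"
    have uc: "u \<in> carrier_vec p" using Q T by (simp add: u_def)
    have "T *\<^sub>v u = (T * Q) *\<^sub>v (T *\<^sub>v unit_vec p j)"
      unfolding u_def using T Q by (simp add: assoc_mult_mat_vec[of _ p n _ p] assoc_mult_mat_vec[of _ n p _ n])
    then have "T *\<^sub>v (u - unit_vec p j) = 0\<^sub>v n"
      using T uc unfolding TQ by (simp add: mult_minus_distrib_mat_vec[of _ n p])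
    then have "u - unit_vec p j = 0\<^sub>v p" using uc by (intro ker) auto
    then have "(u - unit_vec p j) $ i = 0" using ij by simp
    then have "u $ i = unit_vec p j $ i" using uc ij by simp
    moreover have "u $ i = (Q * T) $$ (i, j)"
      unfolding u_def using ij Q T col_as_mult_unit_vec[of "Q * T" p p j] by simp
    ultimately show "(Q * T) $$ (i, j) = 1\<^sub>m p $$ (i, j)" using ij by (simp add: unit_vec_def)
  qed (use T Q in auto)
  have "complex_of_nat n = complex_of_nat p"
    using trace_mult_comm[OF T Q] unfolding TQ QT by simp
  then show ?thesis using that[OF Q TQ QT] by simp
qed

text \<open>The second half of Schur's lemma: subtracting an eigenvalue from \<open>T\<close> leaves an endomorphism that is
  not invertible, hence zero.\<close>

lemma schur_scalar:
  assumes \<sigma>: "simple_rep G n \<sigma>" and T: "T \<in> carrier_mat n n"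
    and comm: "\<And>g. g \<in> carrier G \<Longrightarrow> \<sigma> g * T = T * \<sigma> g"
  obtains c where "T = c \<cdot>\<^sub>m 1\<^sub>m n"
proof -
  have n: "n > 0" and r: "mat_rep G n \<sigma>" using \<sigma> by (auto simp: simple_rep_def)
  obtain c v where v: "v \<in> carrier_vec n" "v \<noteq> 0\<^sub>v n" "T *\<^sub>v v = c \<cdot>\<^sub>v v"
    using spectrum_non_empty[OF T n] T by (auto simp: spectrum_def eigenvalue_def eigenvector_def)
  define U where "U = T - c \<cdot>\<^sub>m 1\<^sub>m n"
  have U: "U \<in> carrier_mat n n" by (auto simp: U_def)
  have Uv: "U *\<^sub>v v = 0\<^sub>v n"
  proof -
    have "(c \<cdot>\<^sub>m 1\<^sub>m n) *\<^sub>v v = c \<cdot>\<^sub>v v"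
      using v(1) by (intro eq_vecI) auto
    then show ?thesis
      unfolding U_def using T v by (simp add: minus_mult_distrib_mat_vec[of _ n n])
  qed
  have commU: "\<sigma> g * U = U * \<sigma> g" if g: "g \<in> carrier G" for g
    unfolding U_def using T mat_repD(1)[OF r g] comm[OF g]
    by (simp add: mult_minus_distrib_mat[of _ n n] minus_mult_distrib_mat[of _ n n]
        mult_smult_distrib[of _ n n _ n] mult_smult_assoc_mat[of _ n n _ n])
  have "U = 0\<^sub>m n n"
  proof (rule ccontr)
    assume "U \<noteq> 0\<^sub>m n n"
    then obtain Q where Q: "Q \<in> carrier_mat n n" "Q * U = 1\<^sub>m n"
      using schur_invertible[OF \<sigma> \<sigma> U commU] by blast
    have "v = (Q * U) *\<^sub>v v" using Q v by simp
    also have "\<dots> = Q *\<^sub>v 0\<^sub>v n" using Q(1) U v Uv by simp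
    also have "\<dots> = 0\<^sub>v n" using Q by (intro eq_vecI) auto
    finally show False using v by simp
  qed
  have "T = c \<cdot>\<^sub>m 1\<^sub>m n"
  proof (rule eq_matI)
    fix i j assume "i < dim_row (c \<cdot>\<^sub>m 1\<^sub>m n)" "j < dim_col (c \<cdot>\<^sub>m 1\<^sub>m n)"
    then have ij: "i < n" "j < n" by auto
    have "U $$ (i, j) = 0" using \<open>U = 0\<^sub>m n n\<close> ij by simp
    then show "T $$ (i, j) = (c \<cdot>\<^sub>m 1\<^sub>m n) $$ (i, j)" using T ij by (simp add: U_def)
  qed (use T in auto)
  then show thesis by (rule that)
qed

text \<open>On characters this is the usual Hermitian inner product, since \<open>\<chi>(g\<^sup>-\<^sup>1)\<close> is the complex conjugate
  of \<open>\<chi>(g)\<close>; this form is bilinear.\<close>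

definition char_ip :: "('a \<Rightarrow> complex) \<Rightarrow> ('a \<Rightarrow> complex) \<Rightarrow> complex" where
  "char_ip \<phi> \<psi> = (\<Sum>g\<in>carrier G. \<phi> g * \<psi> (inv g)) / of_nat (card (carrier G))"

text \<open>Averages of matrix units contain all products of matrix coefficients; this is how Schur's lemma yields
  orthogonality.\<close>

lemma average_entry:
  assumes \<sigma>: "mat_rep G n \<sigma>" and \<tau>: "mat_rep G p \<tau>" and ix: "i < n" "k < n" "l < p" "j < p"
  shows "mat_sum n p (\<lambda>g. \<sigma> g * mat n p (\<lambda>(a, b). if a = k \<and> b = l then 1 else 0) * \<tau> (inv g)) (carrier G) $$ (i, j) =
    (\<Sum>g\<in>carrier G. \<sigma> g $$ (i, k) * \<tau> (inv g) $$ (l, j))"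
proof -
  define Y where "Y = mat n p (\<lambda>(a, b). if a = k \<and> b = l then 1 else 0 :: complex)"
  have Y: "Y \<in> carrier_mat n p" by (simp add: Y_def)
  have "(\<sigma> g * Y * \<tau> (inv g)) $$ (i, j) = \<sigma> g $$ (i, k) * \<tau> (inv g) $$ (l, j)" if g: "g \<in> carrier G" for g
  proof -
    note c = mat_repD(1)[OF \<sigma> g] mat_repD(1)[OF \<tau> inv_closed[OF g]]
    have e: "(\<sigma> g * Y) $$ (i, b) = (if b = l then \<sigma> g $$ (i, k) else 0)" if b: "b < p" for b
    proof -
      have "(\<sigma> g * Y) $$ (i, b) = (\<Sum>a<n. \<sigma> g $$ (i, a) * Y $$ (a, b))"
        using c Y ix b by (simp add: scalar_prod_def atLeast0LessThan)
      also have "\<dots> = (\<Sum>a<n. if a = k then (if b = l then \<sigma> g $$ (i, k) else 0) else 0)"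
        by (rule sum.cong) (use b in \<open>auto simp: Y_def\<close>)
      finally show ?thesis using ix by simp
    qed
    have "(\<sigma> g * Y * \<tau> (inv g)) $$ (i, j) = (\<Sum>b<p. (\<sigma> g * Y) $$ (i, b) * \<tau> (inv g) $$ (b, j))"
      using mat_mult_entry[OF mult_carrier_mat[OF c(1) Y] c(2)] ix by simp
    also have "\<dots> = (\<Sum>b<p. if b = l then \<sigma> g $$ (i, k) * \<tau> (inv g) $$ (l, j) else 0)"
      by (rule sum.cong) (use e in auto)
    finally show ?thesis using ix by simp
  qed
  then show ?thesis using ix unfolding Y_def[symmetric] by (simp add: mat_sum_def)
qed

lemma char_ip_rep:
  assumes \<sigma>: "mat_rep G n \<sigma>" and \<tau>: "mat_rep G p \<tau>"
  shows "char_ip (rep_char \<sigma>) (rep_char \<tau>) =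
    (\<Sum>i<n. \<Sum>l<p. \<Sum>g\<in>carrier G. \<sigma> g $$ (i, i) * \<tau> (inv g) $$ (l, l)) / of_nat (card (carrier G))"
proof -
  have "(\<Sum>g\<in>carrier G. rep_char \<sigma> g * rep_char \<tau> (inv g)) =
      (\<Sum>g\<in>carrier G. \<Sum>i<n. \<Sum>l<p. \<sigma> g $$ (i, i) * \<tau> (inv g) $$ (l, l))"
    by (rule sum.cong)
      (use mat_repD(1)[OF \<sigma>] mat_repD(1)[OF \<tau>, OF inv_closed] in \<open>auto simp: rep_char_def sum_product dest!: carrier_matD(1)\<close>)
  also have "\<dots> = (\<Sum>i<n. \<Sum>l<p. \<Sum>g\<in>carrier G. \<sigma> g $$ (i, i) * \<tau> (inv g) $$ (l, l))"
    by (subst sum.swap, rule sum.cong, rule refl, rule sum.swap)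
  finally show ?thesis by (simp add: char_ip_def)
qed

lemma char_ip_cong:
  assumes "\<And>g. g \<in> carrier G \<Longrightarrow> \<phi> g = \<phi>' g" "\<And>g. g \<in> carrier G \<Longrightarrow> \<psi> g = \<psi>' g"
  shows "char_ip \<phi> \<psi> = char_ip \<phi>' \<psi>'"
  unfolding char_ip_def using assms by (auto intro!: arg_cong2[where f = "(/)"] sum.cong)

lemma char_ip_simple_self:
  assumes \<sigma>: "simple_rep G n \<sigma>"
  shows "char_ip (rep_char \<sigma>) (rep_char \<sigma>) = 1"
proof -
  have n: "n > 0" and r: "mat_rep G n \<sigma>" using \<sigma> by (auto simp: simple_rep_def)
  note rs = mat_repD[OF r]
  have *: "(\<Sum>g\<in>carrier G. \<sigma> g $$ (i, k) * \<sigma> (inv g) $$ (l, j)) =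
      (if i = j \<and> k = l then of_nat (card (carrier G)) / of_nat n else 0)"
    if ix: "i < n" "k < n" "l < n" "j < n" for i j k l
  proof -
    define Y where "Y = mat n n (\<lambda>(a, b). if a = k \<and> b = l then 1 else 0 :: complex)"
    define S where "S = mat_sum n n (\<lambda>g. \<sigma> g * Y * \<sigma> (inv g)) (carrier G)"
    have Sc: "S \<in> carrier_mat n n" by (simp add: S_def)
    have "\<sigma> h * S = S * \<sigma> h" if "h \<in> carrier G" for h
      unfolding S_def by (rule average_intertwines[OF r r _ that]) (simp add: Y_def)
    then obtain c where c: "S = c \<cdot>\<^sub>m 1\<^sub>m n" using schur_scalar[OF \<sigma> Sc] by blast
    have entry: "S $$ (a, b) = (\<Sum>g\<in>carrier G. \<sigma> g $$ (a, k) * \<sigma> (inv g) $$ (l, b))" if "a < n" "b < n" for a b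
      unfolding S_def Y_def by (rule average_entry[OF r r]) (use ix that in auto)
    \<comment> \<open>The scalar is found by taking traces.\<close>
    have "of_nat n * c = (\<Sum>a<n. S $$ (a, a))" unfolding c by simp
    also have "\<dots> = (\<Sum>g\<in>carrier G. \<Sum>a<n. \<sigma> g $$ (a, k) * \<sigma> (inv g) $$ (l, a))"
      by (subst sum.swap) (simp add: entry)
    also have "\<dots> = (\<Sum>g\<in>carrier G. (\<sigma> (inv g) * \<sigma> g) $$ (l, k))"
      by (rule sum.cong)
        (use ix in \<open>auto simp: mat_mult_entry[OF rs(1)[OF inv_closed] rs(1)] mult.commute\<close>)
    also have "\<dots> = (\<Sum>g\<in>carrier G. if k = l then 1 else 0)"
      by (rule sum.cong) (use rs(5) ix in auto)
    finally have "c = (if k = l then of_nat (card (carrier G)) / of_nat n else 0)"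
      using n by (auto simp: field_simps split: if_splits)
    moreover have "S $$ (i, j) = (if i = j then c else 0)" using ix unfolding c by simp
    ultimately show ?thesis using entry[of i j] ix by simp
  qed
  have "(\<Sum>i<n. \<Sum>l<n. \<Sum>g\<in>carrier G. \<sigma> g $$ (i, i) * \<sigma> (inv g) $$ (l, l)) =
      (\<Sum>i<n. \<Sum>l<n. if l = i then of_nat (card (carrier G)) / of_nat n else 0)"
    by (intro sum.cong refl) (auto simp: *)
  also have "\<dots> = of_nat (card (carrier G))" using n by simp
  finally show ?thesis using of_nat_card_nonzero by (simp add: char_ip_rep[OF r r] del: of_nat_eq_0_iff)
qed

lemma char_ip_simple:
  assumes \<sigma>: "simple_rep G n \<sigma>" and \<tau>: "simple_rep G p \<tau>"
  shows "char_ip (rep_char \<sigma>) (rep_char \<tau>) = (if iso_rep G \<sigma> \<tau> then 1 else 0)"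
proof (cases "iso_rep G \<sigma> \<tau>")
  case True
  have "char_ip (rep_char \<sigma>) (rep_char \<tau>) = char_ip (rep_char \<tau>) (rep_char \<tau>)"
    by (rule char_ip_cong) (use rep_char_iso[OF True] in auto)
  then show ?thesis using char_ip_simple_self[OF \<tau>] True by simp
next
  case False
  have r: "mat_rep G n \<sigma>" "mat_rep G p \<tau>" using \<sigma> \<tau> by (auto simp: simple_rep_def)
  have "(\<Sum>g\<in>carrier G. \<sigma> g $$ (i, i) * \<tau> (inv g) $$ (l, l)) = 0" if ix: "i < n" "l < p" for i l
  proof -
    define Y where "Y = mat n p (\<lambda>(a, b). if a = i \<and> b = l then 1 else 0 :: complex)"
    define S where "S = mat_sum n p (\<lambda>g. \<sigma> g * Y * \<tau> (inv g)) (carrier G)"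
    have Sc: "S \<in> carrier_mat n p" by (simp add: S_def)
    have comm: "\<sigma> h * S = S * \<tau> h" if "h \<in> carrier G" for h
      unfolding S_def by (rule average_intertwines[OF r _ that]) (simp add: Y_def)
    have "S = 0\<^sub>m n p"
    proof (rule ccontr)
      assume "S \<noteq> 0\<^sub>m n p"
      then obtain Q where Q: "Q \<in> carrier_mat p n" "S * Q = 1\<^sub>m n" "Q * S = 1\<^sub>m p" and np: "n = p"
        using schur_invertible[OF \<sigma> \<tau> Sc comm] by blast
      have "similar_mat_wit (\<sigma> g) (\<tau> g) S Q" if g: "g \<in> carrier G" for g
      proof (rule similar_mat_witI[of _ _ n])
        note c = mat_repD(1)[OF r(1) g] mat_repD(1)[OF r(2) g]
        have "\<sigma> g = \<sigma> g * (S * Q)" using Q c by simp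
        also have "\<dots> = \<sigma> g * S * Q" using c Sc Q(1) by (simp add: assoc_mult_mat[of _ n n _ p _ n])
        finally show "\<sigma> g = S * \<tau> g * Q" using comm[OF g] by simp
      qed (use Q np Sc mat_repD(1)[OF r(1) g] mat_repD(1)[OF r(2) g] in auto)
      then show False using False unfolding iso_rep_def by blast
    qed
    moreover have "S $$ (i, l) = (\<Sum>g\<in>carrier G. \<sigma> g $$ (i, i) * \<tau> (inv g) $$ (l, l))"
      unfolding S_def Y_def by (rule average_entry[OF r]) (use ix in auto)
    ultimately show ?thesis using ix by simp
  qed
  then show ?thesis using False by (simp add: char_ip_rep[OF r])
qed

section \<open>Complete reducibility and multiplicities\<close>

text \<open>Maschke's theorem for a submodule in coordinates. The upper right block \<open>B\<close> is a cocycle, and the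
  average \<open>Y = - (1 / |G|) \<Sum>\<^sub>h B(h) D(h\<^sup>-\<^sup>1)\<close> satisfies \<open>A(g) Y - Y D(g) = B(g)\<close>, so
  conjugation by the unitriangular matrix with upper right block \<open>Y\<close> removes \<open>B\<close>.\<close>

lemma split_invariant_block:
  assumes A: "mat_rep G k A" and D: "mat_rep G m D"
    and B: "\<And>g. g \<in> carrier G \<Longrightarrow> B g \<in> carrier_mat k m"
    and cocycle: "\<And>g h. g \<in> carrier G \<Longrightarrow> h \<in> carrier G \<Longrightarrow> B (g \<otimes> h) = A g * B h + B g * D h"
  shows "iso_rep G (\<lambda>g. four_block_mat (A g) (B g) (0\<^sub>m m k) (D g))
    (\<lambda>g. four_block_mat (A g) (0\<^sub>m k m) (0\<^sub>m m k) (D g))"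
proof -
  note As = mat_repD[OF A] and Ds = mat_repD[OF D]
  define N where "N = (of_nat (card (carrier G)) :: complex)"
  have N: "N \<noteq> 0" unfolding N_def by (rule of_nat_card_nonzero)
  define S where "S = mat_sum k m (\<lambda>h. B h * D (inv h)) (carrier G)"
  define Y where "Y = (- (1 / N)) \<cdot>\<^sub>m S"
  have S: "S \<in> carrier_mat k m" by (simp add: S_def)
  have Y: "Y \<in> carrier_mat k m" by (simp add: Y_def S)
  have main: "A g * S = S * D g - N \<cdot>\<^sub>m B g" if g: "g \<in> carrier G" for g
  proof -
    have car: "B h * D (inv h) \<in> carrier_mat k m" if "h \<in> carrier G" for h
      using B[OF that] Ds(1)[OF inv_closed[OF that]] by simp
    have "A g * S = mat_sum k m (\<lambda>h. A g * (B h * D (inv h))) (carrier G)"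
      unfolding S_def by (rule mult_mat_sum[OF As(1)[OF g] car])
    also have "\<dots> = mat_sum k m (\<lambda>h. B (g \<otimes> h) * D (inv (g \<otimes> h)) * D g - B g) (carrier G)"
    proof (rule mat_sum_cong)
      fix h assume h: "h \<in> carrier G"
      note c = As(1)[OF g] B[OF h] B[OF g] Ds(1)[OF h] Ds(1)[OF g] Ds(1)[OF inv_closed[OF h]]
        Ds(1)[OF inv_closed[OF m_closed[OF g h]]]
      have "D (inv (g \<otimes> h)) * D g = D (inv h)"
        using g h by (simp add: Ds(3)[symmetric] inv_mult_group m_assoc)
      then have "B (g \<otimes> h) * D (inv (g \<otimes> h)) * D g = B (g \<otimes> h) * D (inv h)"
        using c g h B[of "g \<otimes> h"] by (simp add: assoc_mult_mat[of _ k m _ m _ m])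
      also have "\<dots> = A g * (B h * D (inv h)) + B g * (D h * D (inv h))"
        unfolding cocycle[OF g h] using c
        by (simp add: add_mult_distrib_mat[of _ k m _ _ m] assoc_mult_mat[of _ k m _ m _ m] assoc_mult_mat[of _ k k _ m _ m])
      also have "B g * (D h * D (inv h)) = B g" using c Ds(4)[OF h] by simp
      finally show "A g * (B h * D (inv h)) = B (g \<otimes> h) * D (inv (g \<otimes> h)) * D g - B g"
        using c car[OF h] by (intro eq_matI) auto
    qed
    also have "\<dots> = mat_sum k m (\<lambda>h. B (g \<otimes> h) * D (inv (g \<otimes> h)) * D g) (carrier G) - N \<cdot>\<^sub>m B g"
      using carrier_matD[OF B[OF g]] by (intro eq_matI) (auto simp: mat_sum_def sum_subtractf N_def)
    also have "mat_sum k m (\<lambda>h. B (g \<otimes> h) * D (inv (g \<otimes> h)) * D g) (carrier G)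
        = mat_sum k m (\<lambda>h. B h * D (inv h) * D g) (carrier G)"
      using mat_sum_reindex[OF bij_mult_left[OF g], of k m "\<lambda>h. B h * D (inv h) * D g"] by simp
    also have "\<dots> = S * D g"
      unfolding S_def by (rule mat_sum_mult[OF Ds(1)[OF g] car, symmetric])
    finally show ?thesis .
  qed
  define P where "P = four_block_mat (1\<^sub>m k) (- Y) (0\<^sub>m m k) (1\<^sub>m m)"
  define Q where "Q = four_block_mat (1\<^sub>m k) Y (0\<^sub>m m k) (1\<^sub>m m)"
  have PQ: "P \<in> carrier_mat (k + m) (k + m)" "Q \<in> carrier_mat (k + m) (k + m)"
    by (simp_all add: P_def Q_def)
  have one: "P * Q = 1\<^sub>m (k + m)"
    unfolding P_def Q_def using Y
    by (subst mult_four_block_mat[of _ k k _ m _ m _ _ k _ m]) (auto intro!: eq_matI)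
  have one': "Q * P = 1\<^sub>m (k + m)" by (rule mat_mult_left_right_inverse[OF PQ one])
  have "similar_mat_wit (four_block_mat (A g) (B g) (0\<^sub>m m k) (D g))
      (four_block_mat (A g) (0\<^sub>m k m) (0\<^sub>m m k) (D g)) P Q" if g: "g \<in> carrier G" for g
  proof (rule similar_mat_witI[OF one one'])
    note c = As(1)[OF g] B[OF g] Ds(1)[OF g]
    have AY: "A g * Y = (- (1 / N)) \<cdot>\<^sub>m (A g * S)" "Y * D g = (- (1 / N)) \<cdot>\<^sub>m (S * D g)"
      unfolding Y_def using c S by (simp_all add: mult_smult_distrib[of _ k k _ m] mult_smult_assoc_mat[of _ k m _ m])
    have eq: "A g * Y + - Y * D g = B g"
    proof -
      have "- Y * D g = - (Y * D g)" using c Y by simp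
      then show ?thesis unfolding AY main[OF g] using c S N
        by (intro eq_matI) (auto simp: field_simps)
    qed
    have "P * four_block_mat (A g) (0\<^sub>m k m) (0\<^sub>m m k) (D g) = four_block_mat (A g) (- Y * D g) (0\<^sub>m m k) (D g)"
      unfolding P_def using c Y by (subst mult_four_block_mat[of _ k k _ m _ m _ _ k _ m]) auto
    also have "\<dots> * Q = four_block_mat (A g) (A g * Y + - Y * D g) (0\<^sub>m m k) (D g)"
      unfolding Q_def using c Y by (subst mult_four_block_mat[of _ k k _ m _ m _ _ k _ m]) auto
    finally show "four_block_mat (A g) (B g) (0\<^sub>m m k) (D g) =
        P * four_block_mat (A g) (0\<^sub>m k m) (0\<^sub>m m k) (D g) * Q" unfolding eq ..
  qed (use PQ As(1)[OF g] B[OF g] Ds(1)[OF g] in auto)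
  then show ?thesis unfolding iso_rep_def by blast
qed

text \<open>In a basis adapted to a proper nonzero submodule all matrices are block upper triangular, so a
  complement exists by averaging.\<close>

lemma not_simple_splits:
  assumes \<rho>: "mat_rep G n \<rho>" and n: "n > 0" and ns: "\<not> simple_rep G n \<rho>"
  obtains k m A D where "0 < k" "0 < m" "n = k + m" "mat_rep G k A" "mat_rep G m D"
    "iso_rep G \<rho> (\<lambda>g. four_block_mat (A g) (0\<^sub>m k m) (0\<^sub>m m k) (D g))"
proof -
  note \<rho>s = mat_repD[OF \<rho>]
  obtain W where W: "submodule_of G n \<rho> W" "W \<noteq> {0\<^sub>v n}" "W \<noteq> carrier_vec n"
    using ns \<rho> n by (auto simp: simple_rep_def)
  then have sub: "subspace class_ring W (module_vec TYPE(complex) n)"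
    and stable: "\<And>g w. g \<in> carrier G \<Longrightarrow> w \<in> W \<Longrightarrow> \<rho> g *\<^sub>v w \<in> W"
    by (auto simp: submodule_of_def)
  have Wc: "W \<subseteq> carrier_vec n" "0\<^sub>v n \<in> W" using sub unfolding subspace_iff by auto
  obtain k P Q where k: "k \<le> n" and P: "P \<in> carrier_mat n n" and Q: "Q \<in> carrier_mat n n"
    and PQ: "P * Q = 1\<^sub>m n" and QP: "Q * P = 1\<^sub>m n"
    and mem: "\<And>v. v \<in> carrier_vec n \<Longrightarrow> v \<in> W \<longleftrightarrow> (\<forall>i. k \<le> i \<and> i < n \<longrightarrow> (Q *\<^sub>v v) $ i = 0)"
    using subspace_adapted_basis[OF sub] by metis
  have k0: "0 < k"
  proof (rule ccontr)
    assume "\<not> 0 < k"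
    have "v = 0\<^sub>v n" if v: "v \<in> W" for v
    proof -
      have vc: "v \<in> carrier_vec n" using v Wc by blast
      have "Q *\<^sub>v v = 0\<^sub>v n" using mem[OF vc] v \<open>\<not> 0 < k\<close> Q by (intro eq_vecI) auto
      then have "P *\<^sub>v (Q *\<^sub>v v) = 0\<^sub>v n" using P by (intro eq_vecI) auto
      then show ?thesis using assoc_mult_mat_vec[OF P Q vc] PQ vc by simp
    qed
    then show False using W Wc by blast
  qed
  have kn: "k < n"
  proof (rule ccontr)
    assume "\<not> k < n"
    then have "W = carrier_vec n" using mem Wc by auto
    then show False using W by simp
  qed
  define m where "m = n - k"
  have m: "0 < m" "n = k + m" using kn by (auto simp: m_def)
  define \<rho>' where "\<rho>' g = Q * \<rho> g * P" for g
  have \<rho>'c: "\<rho>' g \<in> carrier_mat (k + m) (k + m)" if "g \<in> carrier G" for g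
    using P Q \<rho>s(1)[OF that] m by (simp add: \<rho>'_def)
  have colP: "col P j \<in> W" if j: "j < k" for j
  proof -
    have c: "col P j \<in> carrier_vec n" using P by (intro carrier_vecI) simp
    have "Q *\<^sub>v col P j = col (Q * P) j" using j kn P Q by (simp add: col_mult2[of _ n n _ n] del: col_mult)
    also have "\<dots> = unit_vec n j" unfolding QP using j kn by simp
    finally show ?thesis using mem[OF c] j by auto
  qed
  define A where "A g = mat k k (\<lambda>(i, j). \<rho>' g $$ (i, j))" for g
  define B where "B g = mat k m (\<lambda>(i, j). \<rho>' g $$ (i, j + k))" for g
  define D where "D g = mat m m (\<lambda>(i, j). \<rho>' g $$ (i + k, j + k))" for g
  have car: "A g \<in> carrier_mat k k" "B g \<in> carrier_mat k m" "D g \<in> carrier_mat m m" for g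
    by (simp_all add: A_def B_def D_def)
  have block: "\<rho>' g = four_block_mat (A g) (B g) (0\<^sub>m m k) (D g)" if g: "g \<in> carrier G" for g
  proof (rule eq_matI)
    fix i j assume "i < dim_row (four_block_mat (A g) (B g) (0\<^sub>m m k) (D g))"
      "j < dim_col (four_block_mat (A g) (B g) (0\<^sub>m m k) (D g))"
    then have ij: "i < k + m" "j < k + m" using car[of g] by auto
    have "\<rho>' g $$ (i, j) = 0" if c: "\<not> i < k" "j < k"
    proof -
      have cP: "col P j \<in> carrier_vec n" using P by (intro carrier_vecI) simp
      have w: "\<rho> g *\<^sub>v col P j \<in> W" by (rule stable[OF g colP[OF c(2)]])
      then have "(Q *\<^sub>v (\<rho> g *\<^sub>v col P j)) $ i = 0"
        using mem[of "\<rho> g *\<^sub>v col P j"] Wc c ij m(2) by (auto simp: not_less)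
      moreover have "Q *\<^sub>v (\<rho> g *\<^sub>v col P j) = col (\<rho>' g) j"
        using P Q \<rho>s(1)[OF g] ij m(2) cP unfolding \<rho>'_def
        by (simp add: col_mult2[of _ n n _ n] assoc_mult_mat_vec[of _ n n _ n] del: col_mult)
      ultimately show ?thesis using \<rho>'c[OF g] ij by simp
    qed
    then show "\<rho>' g $$ (i, j) = four_block_mat (A g) (B g) (0\<^sub>m m k) (D g) $$ (i, j)"
      using ij car[of g] by (auto simp: A_def B_def D_def)
  qed (use \<rho>'c[OF g] car[of g] in auto)
  have blocks_mult: "A (g \<otimes> h) = A g * A h \<and> B (g \<otimes> h) = A g * B h + B g * D h \<and> D (g \<otimes> h) = D g * D h"
    if gh: "g \<in> carrier G" "h \<in> carrier G" for g h
  proof -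
    note c = \<rho>s(1)[OF gh(1)] \<rho>s(1)[OF gh(2)]
    have "\<rho>' g * \<rho>' h = Q * \<rho> g * ((P * Q) * (\<rho> h * P))"
      unfolding \<rho>'_def using c P Q by (simp add: assoc_mult_mat[of _ n n _ n _ n])
    also have "\<dots> = \<rho>' (g \<otimes> h)"
      unfolding \<rho>'_def PQ \<rho>s(3)[OF gh] using c P Q by (simp add: assoc_mult_mat[of _ n n _ n _ n])
    finally have "four_block_mat (A (g \<otimes> h)) (B (g \<otimes> h)) (0\<^sub>m m k) (D (g \<otimes> h)) =
        four_block_mat (A g) (B g) (0\<^sub>m m k) (D g) * four_block_mat (A h) (B h) (0\<^sub>m m k) (D h)"
      using gh by (simp add: block)
    also have "\<dots> = four_block_mat (A g * A h) (A g * B h + B g * D h) (0\<^sub>m m k) (D g * D h)"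
      using car[of g] car[of h] by (subst mult_four_block_mat[of _ k k _ m _ m _ _ k _ m]) auto
    finally show ?thesis
      using car[of g] car[of h] car[of "g \<otimes> h"] by (intro four_block_mat_inject[where C = "0\<^sub>m m k" and C' = "0\<^sub>m m k"]) auto
  qed
  have "\<rho>' \<one> = 1\<^sub>m (k + m)" unfolding \<rho>'_def \<rho>s(2) using Q QP m(2) by simp
  then have "A \<one> = 1\<^sub>m k" "D \<one> = 1\<^sub>m m" by (auto simp: A_def D_def intro!: eq_matI)
  then have reps: "mat_rep G k A" "mat_rep G m D"
    using car blocks_mult by (auto simp: mat_rep_def)
  have "similar_mat_wit (\<rho> g) (four_block_mat (A g) (B g) (0\<^sub>m m k) (D g)) P Q" if g: "g \<in> carrier G" for g
    unfolding block[OF g, symmetric]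
  proof (rule similar_mat_witI[OF PQ QP])
    have "P * \<rho>' g * Q = (P * Q) * (\<rho> g * (P * Q))"
      unfolding \<rho>'_def using \<rho>s(1)[OF g] P Q by (simp add: assoc_mult_mat[of _ n n _ n _ n])
    then show "\<rho> g = P * \<rho>' g * Q" unfolding PQ using \<rho>s(1)[OF g] by simp
  qed (use \<rho>s(1)[OF g] \<rho>'c[OF g] P Q m in auto)
  then have "iso_rep G \<rho> (\<lambda>g. four_block_mat (A g) (B g) (0\<^sub>m m k) (D g))"
    unfolding iso_rep_def by blast
  moreover have "iso_rep G (\<lambda>g. four_block_mat (A g) (B g) (0\<^sub>m m k) (D g))
      (\<lambda>g. four_block_mat (A g) (0\<^sub>m k m) (0\<^sub>m m k) (D g))"
    by (rule split_invariant_block[OF reps]) (use car blocks_mult in auto)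
  ultimately show ?thesis using that[OF k0 m reps] iso_rep_trans by blast
qed

lemma completely_reducible:
  assumes "mat_rep G n \<rho>"
  shows "\<exists>\<rho>s. (\<forall>\<rho>'\<in>set \<rho>s. \<exists>n. simple_rep G n \<rho>') \<and> iso_rep G \<rho> (direct_sum_rep \<rho>s)"
  using assms
proof (induction n arbitrary: \<rho> rule: less_induct)
  case (less n)
  consider "n = 0" | "simple_rep G n \<rho>" | "n > 0" "\<not> simple_rep G n \<rho>" by blast
  then show ?case
  proof cases
    case 1
    have "similar_mat_wit (\<rho> g) (direct_sum_rep [] g) (1\<^sub>m 0) (1\<^sub>m 0)" if "g \<in> carrier G" for g
      using mat_repD(1)[OF less.prems that] 1
      by (intro similar_mat_witI[of _ _ 0]) (auto simp: direct_sum_rep_def)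
    then have "iso_rep G \<rho> (direct_sum_rep [])" unfolding iso_rep_def by blast
    then show ?thesis by (intro exI[of _ "[]"]) simp
  next
    case 2
    have "direct_sum_rep [\<rho>] = \<rho>"
      by (simp only: direct_sum_rep_def list.map diag_block_mat_singleton)
    then show ?thesis using 2 iso_rep_refl[OF less.prems] by (intro exI[of _ "[\<rho>]"]) auto
  next
    case 3
    then obtain k m A D where km: "0 < k" "0 < m" "n = k + m" and r: "mat_rep G k A" "mat_rep G m D"
      and iso: "iso_rep G \<rho> (\<lambda>g. four_block_mat (A g) (0\<^sub>m k m) (0\<^sub>m m k) (D g))"
      using not_simple_splits[OF less.prems] by metis
    obtain \<rho>s where 1: "\<forall>\<rho>'\<in>set \<rho>s. \<exists>n. simple_rep G n \<rho>'" "iso_rep G A (direct_sum_rep \<rho>s)"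
      using less.IH[of k A] km r by auto
    obtain \<sigma>s where 2: "\<forall>\<rho>'\<in>set \<sigma>s. \<exists>n. simple_rep G n \<rho>'" "iso_rep G D (direct_sum_rep \<sigma>s)"
      using less.IH[of m D] km r by auto
    have "iso_rep G \<rho> (direct_sum_rep (\<rho>s @ \<sigma>s))"
      by (rule iso_rep_trans[OF iso iso_rep_block_diag[OF 1(2) 2(2) r]])
    then show ?thesis using 1 2 by (intro exI[of _ "\<rho>s @ \<sigma>s"]) auto
  qed
qed

lemma char_ip_direct_sum:
  assumes simple: "\<forall>\<rho>'\<in>set \<rho>s. \<exists>n. simple_rep G n \<rho>'" and \<tau>: "simple_rep G p \<tau>"
  shows "char_ip (rep_char (direct_sum_rep \<rho>s)) (rep_char \<tau>) = of_nat (length (filter (iso_rep G \<tau>) \<rho>s))"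
proof -
  have "char_ip (rep_char (direct_sum_rep \<rho>s)) (rep_char \<tau>) =
      char_ip (\<lambda>g. \<Sum>\<rho>\<leftarrow>\<rho>s. rep_char \<rho> g) (rep_char \<tau>)"
  proof (rule char_ip_cong)
    fix g assume g: "g \<in> carrier G"
    show "rep_char (direct_sum_rep \<rho>s) g = (\<Sum>\<rho>\<leftarrow>\<rho>s. rep_char \<rho> g)"
    proof (rule rep_char_direct_sum)
      fix \<rho> assume "\<rho> \<in> set \<rho>s"
      then obtain n where "mat_rep G n \<rho>" using simple by (auto simp: simple_rep_def)
      then show "dim_col (\<rho> g) = dim_row (\<rho> g)" using mat_repD(1)[of n \<rho> g] g by auto
    qed
  qed simp
  also have "\<dots> = of_nat (length (filter (iso_rep G \<tau>) \<rho>s))"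
    using simple
  proof (induction \<rho>s)
    case Nil
    show ?case by (simp add: char_ip_def)
  next
    case (Cons \<rho> \<rho>s)
    obtain n where n: "simple_rep G n \<rho>" using Cons.prems by auto
    have "char_ip (\<lambda>g. \<Sum>\<rho>\<leftarrow>\<rho> # \<rho>s. rep_char \<rho> g) (rep_char \<tau>) =
        char_ip (rep_char \<rho>) (rep_char \<tau>) + char_ip (\<lambda>g. \<Sum>\<rho>\<leftarrow>\<rho>s. rep_char \<rho> g) (rep_char \<tau>)"
      by (simp add: char_ip_def distrib_right sum.distrib add_divide_distrib)
    moreover have "iso_rep G \<rho> \<tau> \<longleftrightarrow> iso_rep G \<tau> \<rho>" using iso_rep_sym by blast
    ultimately show ?case using Cons char_ip_simple[OF n \<tau>] by simp
  qed
  finally show ?thesis .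
qed

text \<open>The inner product does not depend on a decomposition, which makes the multiplicity well defined.\<close>

lemma multiplicity_char_ip:
  assumes \<rho>: "mat_rep G n \<rho>" and \<tau>: "simple_rep G p \<tau>"
  shows "of_nat (multiplicity_rep G \<tau> \<rho>) = char_ip (rep_char \<rho>) (rep_char \<tau>)"
proof -
  define Pr where "Pr k \<longleftrightarrow> (\<exists>\<rho>s. (\<forall>\<rho>'\<in>set \<rho>s. \<exists>n. simple_rep G n \<rho>') \<and>
     iso_rep G \<rho> (direct_sum_rep \<rho>s) \<and> k = length (filter (iso_rep G \<tau>) \<rho>s))" for k
  have ip: "of_nat k = char_ip (rep_char \<rho>) (rep_char \<tau>)" if "Pr k" for k
  proof -
    obtain \<rho>s where s: "\<forall>\<rho>'\<in>set \<rho>s. \<exists>n. simple_rep G n \<rho>'" "iso_rep G \<rho> (direct_sum_rep \<rho>s)"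
      "k = length (filter (iso_rep G \<tau>) \<rho>s)" using \<open>Pr k\<close> unfolding Pr_def by blast
    have "char_ip (rep_char \<rho>) (rep_char \<tau>) = char_ip (rep_char (direct_sum_rep \<rho>s)) (rep_char \<tau>)"
      by (rule char_ip_cong) (use rep_char_iso[OF s(2)] in auto)
    then show ?thesis using char_ip_direct_sum[OF s(1) \<tau>] s(3) by simp
  qed
  obtain k where k: "Pr k" unfolding Pr_def using completely_reducible[OF \<rho>] by blast
  moreover have "l = k" if "Pr l" for l
    using ip[OF that] ip[OF k] by (metis of_nat_eq_iff)
  ultimately have "multiplicity_rep G \<tau> \<rho> = k"
    unfolding multiplicity_rep_def Pr_def[symmetric] by (rule the_equality)
  then show ?thesis using ip[OF k] by simp
qed

end

section \<open>Kronecker products and tensor powers\<close>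

lemma sum_div_mod:
  fixes F :: "nat \<Rightarrow> nat \<Rightarrow> 'b :: comm_monoid_add"
  shows "(\<Sum>k<a * b. F (k div b) (k mod b)) = (\<Sum>i<a. \<Sum>j<b. F i j)"
proof -
  have lt: "i * b + j < a * b" if "i < a" "j < b" for i j
  proof -
    have "i * b + j < Suc i * b" using that by simp
    also have "\<dots> \<le> a * b" using that by (intro mult_le_mono1) simp
    finally show ?thesis .
  qed
  have md: "k mod b < b" if "k < a * b" for k
    using that by (cases b) auto
  have "(\<Sum>i<a. \<Sum>j<b. F i j) = (\<Sum>(i, j)\<in>{..<a} \<times> {..<b}. F i j)"
    by (simp add: sum.cartesian_product)
  also have "\<dots> = (\<Sum>k<a * b. F (k div b) (k mod b))"
    by (rule sum.reindex_bij_witness[of _ "\<lambda>k. (k div b, k mod b)" "\<lambda>(i, j). i * b + j"])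
      (use lt md in \<open>auto simp: less_mult_imp_div_less\<close>)
  finally show ?thesis ..
qed

lemma kronecker_carrier:
  "A \<in> carrier_mat a a' \<Longrightarrow> B \<in> carrier_mat b b' \<Longrightarrow> kronecker A B \<in> carrier_mat (a * b) (a' * b')"
  by (auto simp: kronecker_def)

lemma kronecker_mult:
  assumes A: "A \<in> carrier_mat a a" "A' \<in> carrier_mat a a" and B: "B \<in> carrier_mat b b" "B' \<in> carrier_mat b b"
  shows "kronecker A B * kronecker A' B' = kronecker (A * A') (B * B')"
proof (rule eq_matI)
  note K = kronecker_carrier[OF A(1) B(1)] kronecker_carrier[OF A(2) B(2)]
  fix i j assume "i < dim_row (kronecker (A * A') (B * B'))" "j < dim_col (kronecker (A * A') (B * B'))"
  then have ij: "i < a * b" "j < a * b" using A B by (auto simp: kronecker_def)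
  then have b: "0 < b" by (auto intro: gr0I)
  have dm: "i div b < a" "j div b < a" "i mod b < b" "j mod b < b"
    using ij b by (auto simp: less_mult_imp_div_less)
  have "(kronecker A B * kronecker A' B') $$ (i, j) =
      (\<Sum>k<a * b. kronecker A B $$ (i, k) * kronecker A' B' $$ (k, j))"
    by (rule mat_mult_entry[OF K ij])
  also have "\<dots> = (\<Sum>k<a * b. (A $$ (i div b, k div b) * A' $$ (k div b, j div b)) *
      (B $$ (i mod b, k mod b) * B' $$ (k mod b, j mod b)))"
    by (rule sum.cong) (use A B ij in \<open>auto simp: kronecker_def\<close>)
  also have "\<dots> = (\<Sum>k<a. \<Sum>l<b. (A $$ (i div b, k) * A' $$ (k, j div b)) *
      (B $$ (i mod b, l) * B' $$ (l, j mod b)))"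
    by (rule sum_div_mod)
  also have "\<dots> = (A * A') $$ (i div b, j div b) * (B * B') $$ (i mod b, j mod b)"
    by (simp only: mat_mult_entry[OF A dm(1,2)] mat_mult_entry[OF B dm(3,4)] sum_product)
  also have "\<dots> = kronecker (A * A') (B * B') $$ (i, j)"
    using A B ij by (simp add: kronecker_def)
  finally show "(kronecker A B * kronecker A' B') $$ (i, j) = kronecker (A * A') (B * B') $$ (i, j)" .
qed (use A B in \<open>auto simp: kronecker_def\<close>)

lemma kronecker_one: "kronecker (1\<^sub>m a) (1\<^sub>m b) = 1\<^sub>m (a * b)"
proof (rule eq_matI)
  fix i j assume "i < dim_row (1\<^sub>m (a * b))" "j < dim_col (1\<^sub>m (a * b))"
  then have ij: "i < a * b" "j < a * b" by auto
  then have b: "0 < b" by (auto intro: gr0I)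
  have "i div b < a" "j div b < a" using ij by (auto simp: less_mult_imp_div_less)
  moreover have "i = j \<longleftrightarrow> i div b = j div b \<and> i mod b = j mod b"
    by (metis div_mult_mod_eq)
  ultimately show "kronecker (1\<^sub>m a) (1\<^sub>m b) $$ (i, j) = 1\<^sub>m (a * b) $$ (i, j)"
    using ij b by (auto simp: kronecker_def)
qed (auto simp: kronecker_def)

lemma kronecker_trace:
  assumes A: "A \<in> carrier_mat a a" and B: "B \<in> carrier_mat b b"
  shows "(\<Sum>i<a * b. kronecker A B $$ (i, i)) = (\<Sum>i<a. A $$ (i, i)) * (\<Sum>i<b. B $$ (i, i))"
proof -
  have "(\<Sum>i<a * b. kronecker A B $$ (i, i)) = (\<Sum>i<a * b. A $$ (i div b, i div b) * B $$ (i mod b, i mod b))"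
    by (rule sum.cong) (use A B in \<open>auto simp: kronecker_def\<close>)
  then show ?thesis
    using sum_div_mod[of "\<lambda>i j. A $$ (i, i) * B $$ (j, j)" b a] by (simp add: sum_product)
qed

lemma mat_rep_tensor_power:
  assumes "mat_rep G n \<rho>" "Group.group G"
  shows "mat_rep G (n ^ d) (tensor_power_rep d \<rho>)"
proof (induction d)
  case 0
  show ?case by (simp add: mat_rep_def)
next
  case (Suc d)
  interpret Group.group G by (rule assms(2))
  show ?case
    using assms(1) Suc
    by (auto simp: mat_rep_def kronecker_one kronecker_carrier kronecker_mult[of _ n _ _ "n ^ d"])
qed

lemma rep_char_tensor_power:
  assumes \<rho>: "mat_rep G n \<rho>" and G: "Group.group G" and g: "g \<in> carrier G"
  shows "rep_char (tensor_power_rep d \<rho>) g = rep_char \<rho> g ^ d"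
proof (induction d)
  case 0
  show ?case by (simp add: rep_char_def)
next
  case (Suc d)
  have A: "\<rho> g \<in> carrier_mat n n" using \<rho> g by (simp add: mat_rep_def)
  have B: "tensor_power_rep d \<rho> g \<in> carrier_mat (n ^ d) (n ^ d)"
    using mat_rep_tensor_power[OF \<rho> G, of d] g by (simp add: mat_rep_def)
  have "dim_row (kronecker (\<rho> g) (tensor_power_rep d \<rho> g)) = n * n ^ d"
    using kronecker_carrier[OF A B] by auto
  then have "rep_char (tensor_power_rep (Suc d) \<rho>) g =
      (\<Sum>i<n * n ^ d. kronecker (\<rho> g) (tensor_power_rep d \<rho> g) $$ (i, i))"
    by (simp add: rep_char_def)
  also have "\<dots> = rep_char \<rho> g * rep_char (tensor_power_rep d \<rho>) g"
    unfolding kronecker_trace[OF A B] using A B by (simp add: rep_char_def)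
  finally show ?case using Suc by simp
qed

section \<open>Words and convolution powers\<close>

definition word_sum :: "('g, 'b) monoid_scheme \<Rightarrow> ('g \<Rightarrow> real) \<Rightarrow> nat \<Rightarrow> 'g \<Rightarrow> real" where
  "word_sum G f d g = (\<Sum>w\<in>cayley_words G (supp f) g d. word_weight f w)"

lemma word_sum_0: "word_sum G f 0 = ga_elem \<one>\<^bsub>G\<^esub>"
proof
  fix g
  have "cayley_words G (supp f) g 0 = (if g = \<one>\<^bsub>G\<^esub> then {[]} else {})"
    by (auto simp: cayley_words_def)
  then show "word_sum G f 0 g = ga_elem \<one>\<^bsub>G\<^esub> g"
    by (simp add: word_sum_def word_weight_def ga_elem_def)
qed

context finite_group
begin

lemma finite_cayley_words: "S \<subseteq> carrier G \<Longrightarrow> finite (cayley_words G S g d)"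
  by (rule finite_subset[OF _ finite_lists_length_eq[of S d]])
    (auto simp: cayley_words_def intro: finite_subset[OF _ finite_carrier])

text \<open>Splitting off the first letter of a word.\<close>

lemma word_sum_Suc:
  assumes S: "supp f \<subseteq> carrier G"
  shows "word_sum G f (Suc d) = ga_mult G f (word_sum G f d)"
proof
  fix x
  define T where "T = {(u, v). u \<in> supp f \<and> v \<in> carrier G \<and> u \<otimes> v = x}"
  have fT: "finite T"
    by (rule finite_subset[of _ "carrier G \<times> carrier G"]) (use S in \<open>auto simp: T_def\<close>)
  have closed: "foldr (\<otimes>) w \<one> \<in> carrier G" if "set w \<subseteq> supp f" for w
    using that S by (induction w) auto
  have words: "cayley_words G (supp f) x (Suc d) =
      (\<lambda>((u, v), w). u # w) ` Sigma T (\<lambda>(u, v). cayley_words G (supp f) v d)"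
  proof
    show "cayley_words G (supp f) x (Suc d) \<subseteq>
        (\<lambda>((u, v), w). u # w) ` Sigma T (\<lambda>(u, v). cayley_words G (supp f) v d)"
    proof
      fix w' assume "w' \<in> cayley_words G (supp f) x (Suc d)"
      then obtain u w where w: "w' = u # w" "length w = d" "u \<in> supp f" "set w \<subseteq> supp f"
        "u \<otimes> foldr (\<otimes>) w \<one> = x" by (cases w') (auto simp: cayley_words_def)
      then show "w' \<in> (\<lambda>((u, v), w). u # w) ` Sigma T (\<lambda>(u, v). cayley_words G (supp f) v d)"
        by (intro image_eqI[of _ _ "((u, foldr (\<otimes>) w \<one>), w)"]) (auto simp: T_def cayley_words_def closed)
    qed
  qed (auto simp: T_def cayley_words_def)
  have inj: "inj_on (\<lambda>((u, v), w). u # w) (Sigma T (\<lambda>(u, v). cayley_words G (supp f) v d))"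
    by (auto simp: inj_on_def cayley_words_def)
  have "word_sum G f (Suc d) x = (\<Sum>((u, v), w)\<in>Sigma T (\<lambda>(u, v). cayley_words G (supp f) v d). f u * word_weight f w)"
    unfolding word_sum_def words sum.reindex[OF inj]
    by (rule sum.cong) (auto simp: word_weight_def)
  also have "\<dots> = (\<Sum>p\<in>T. \<Sum>w\<in>cayley_words G (supp f) (snd p) d. f (fst p) * word_weight f w)"
    using fT finite_cayley_words[OF S]
    by (subst sum.Sigma) (auto intro!: sum.cong simp: split_beta)
  also have "\<dots> = (\<Sum>p\<in>T. f (fst p) * word_sum G f d (snd p))"
    by (simp add: word_sum_def sum_distrib_left)
  also have "\<dots> = (\<Sum>p\<in>carrier G \<times> carrier G. if fst p \<otimes> snd p = x then f (fst p) * word_sum G f d (snd p) else 0)"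
    by (rule sum.mono_neutral_cong_left) (use S in \<open>auto simp: T_def supp_def\<close>)
  also have "\<dots> = ga_mult G f (word_sum G f d) x"
    by (simp add: ga_mult_def sum.cartesian_product split_beta)
  finally show "word_sum G f (Suc d) x = ga_mult G f (word_sum G f d) x" .
qed

lemma ga_mult_outside: "x \<notin> carrier G \<Longrightarrow> ga_mult G f h x = 0"
  by (auto simp: ga_mult_def intro!: sum.neutral)

lemma ga_mult_eq:
  assumes x: "x \<in> carrier G"
  shows "ga_mult G f h x = (\<Sum>u\<in>carrier G. f u * h (inv u \<otimes> x))"
  unfolding ga_mult_def
proof (rule sum.cong)
  fix u assume u: "u \<in> carrier G"
  have "(\<Sum>v\<in>carrier G. if u \<otimes> v = x then f u * h v else 0) =
      (\<Sum>v\<in>carrier G. if v = inv u \<otimes> x then f u * h v else 0)"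
    by (rule sum.cong) (use inv_solve_left[OF _ u x] in auto)
  then show "(\<Sum>v\<in>carrier G. if u \<otimes> v = x then f u * h v else 0) = f u * h (inv u \<otimes> x)"
    using u x by simp
qed simp

lemma sum_ga_mult:
  fixes L :: "'a \<Rightarrow> complex"
  shows "(\<Sum>x\<in>carrier G. of_real (ga_mult G f h x) * L x) =
    (\<Sum>u\<in>carrier G. \<Sum>v\<in>carrier G. of_real (f u) * of_real (h v) * L (u \<otimes> v))"
proof -
  have "(\<Sum>x\<in>carrier G. of_real (ga_mult G f h x) * L x) =
      (\<Sum>x\<in>carrier G. \<Sum>u\<in>carrier G. \<Sum>v\<in>carrier G. if u \<otimes> v = x then of_real (f u) * of_real (h v) * L x else 0)"
    by (auto simp: ga_mult_def sum_distrib_right intro!: sum.cong)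
  also have "\<dots> = (\<Sum>u\<in>carrier G. \<Sum>v\<in>carrier G. \<Sum>x\<in>carrier G. if u \<otimes> v = x then of_real (f u) * of_real (h v) * L x else 0)"
    by (subst sum.swap, rule sum.cong, rule refl, rule sum.swap)
  also have "\<dots> = (\<Sum>u\<in>carrier G. \<Sum>v\<in>carrier G. of_real (f u) * of_real (h v) * L (u \<otimes> v))"
    by (intro sum.cong refl) simp
  finally show ?thesis .
qed

end

section \<open>The algebra \<open>Q\<close>\<close>

text \<open>With \<open>t = rs\<close> the two group elements compared here are \<open>r\<^sup>i\<close> and \<open>r\<^sup>-\<^sup>i t\<close>, the support of
  \<open>y\<^sub>i\<close>. The exponents \<open>i\<close> with \<open>2 i \<equiv> 0\<close> are those of \<open>e, rs, r\<^sup>k, r\<^sup>k\<^sup>+\<^sup>1 s\<close>, where both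
  coefficients are free. This describes \<open>Q\<close> without reference to the basis (\<open>Q_alg_iff\<close>).\<close>

definition balanced :: "nat \<Rightarrow> (dih \<Rightarrow> real) \<Rightarrow> bool" where
  "balanced m f \<longleftrightarrow> (\<forall>g. g \<notin> carrier (dihedral m) \<longrightarrow> f g = 0) \<and>
     (\<forall>i. \<not> int m dvd 2 * i \<longrightarrow> f (i mod int m, False) = f ((1 - i) mod int m, True))"

lemma balanced_pair:
  assumes m: "m \<ge> 3"
  shows "balanced m (\<lambda>g. ga_elem ((1 - i) mod int m, True) g + ga_elem (i mod int m, False) g)"
  unfolding balanced_def
proof (intro conjI allI impI)
  have in_carrier: "(x mod int m, b) \<in> carrier (dihedral m)" for x b
    using m by simp
  show "ga_elem ((1 - i) mod int m, True) g + ga_elem (i mod int m, False) g = 0"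
    if "g \<notin> carrier (dihedral m)" for g
  proof -
    have "g \<noteq> ((1 - i) mod int m, True)" "g \<noteq> (i mod int m, False)" using that in_carrier by metis+
    then show ?thesis by (simp add: ga_elem_def)
  qed
next
  fix j
  have "(1 - j) mod int m = (1 - i) mod int m \<longleftrightarrow> j mod int m = i mod int m"
    unfolding mod_eq_dvd_iff using dvd_minus_iff[of "int m" "j - i"] by simp
  then show "ga_elem ((1 - i) mod int m, True) (j mod int m, False) + ga_elem (i mod int m, False) (j mod int m, False) =
      ga_elem ((1 - i) mod int m, True) ((1 - j) mod int m, True) + ga_elem (i mod int m, False) ((1 - j) mod int m, True)"
    by (simp add: ga_elem_def)
qed

lemma basis_elem_balanced:
  assumes m: "m \<ge> 3" and j: "j \<in> basis_indices m"
  shows "balanced m (basis_elem m j)"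
proof -
  have small: "int (m div 2) + 1 < int m" using m by linarith
  have meq: "x mod int m = y mod int m \<longleftrightarrow> int m dvd x - y" for x y by (rule mod_eq_dvd_iff)
  have ev: "2 * int (m div 2) = int m" if "even m" using that by auto
  show ?thesis
  proof (cases j)
    case B_e
    have "int m dvd 2 * i" if "i mod int m = 0" for i using that by (auto simp: mod_eq_0_iff_dvd)
    then show ?thesis using B_e m by (auto simp: balanced_def ga_elem_def)
  next
    case B_rs
    have "int m dvd 2 * i" if "(1 - i) mod int m = 1" for i
    proof -
      have "(1 - i) mod int m = 1 mod int m" using that m by simp
      then have "int m dvd - i" unfolding meq by simp
      then show ?thesis by simp
    qed
    moreover have "basis_elem m j = ga_elem (1, True)"
      using B_rs m by (simp add: dih_r_def dih_s_def)
    ultimately show ?thesis using m by (auto simp: balanced_def ga_elem_def)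
  next
    case B_rk
    then have e: "even m" using j by (auto simp: basis_indices_def split: if_splits)
    have k: "int (m div 2) mod int m = int (m div 2)" using small by simp
    have "int m dvd 2 * i" if "i mod int m = int (m div 2)" for i
    proof -
      have "i mod int m = int (m div 2) mod int m" using that k by simp
      then have "int m dvd 2 * (i - int (m div 2)) + int m"
        unfolding meq by (intro dvd_add dvd_mult) simp_all
      then show ?thesis using ev[OF e] by (simp add: algebra_simps)
    qed
    moreover have "basis_elem m j = ga_elem (int (m div 2), False)"
      using B_rk k by (simp add: dih_r_pow_nat[OF m])
    ultimately show ?thesis using m small by (auto simp: balanced_def ga_elem_def)
  next
    case B_rk1s
    then have e: "even m" using j by (auto simp: basis_indices_def split: if_splits)
    have k: "(int (m div 2) + 1) mod int m = int (m div 2) + 1" using small by simp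
    have "int m dvd 2 * i" if "(1 - i) mod int m = int (m div 2) + 1" for i
    proof -
      have "(1 - i) mod int m = (int (m div 2) + 1) mod int m" using that k by simp
      then have "int m dvd 2 * ((1 - i) - (int (m div 2) + 1)) + int m"
        unfolding meq by (intro dvd_add dvd_mult) simp_all
      then have "int m dvd - (2 * i)" using ev[OF e] by (simp add: algebra_simps)
      then show ?thesis by simp
    qed
    moreover have "basis_elem m j = ga_elem (int (m div 2) + 1, True)"
      using B_rk1s k m by (simp only: basis_elem.simps dih_r_pow_nat[OF m] dih_s_def) (simp add: add.commute)
    ultimately show ?thesis using m small by (auto simp: balanced_def ga_elem_def)
  next
    case (B_y a)
    then show ?thesis using balanced_pair[OF m, of "int a"] y_elem_eq[OF m] by simp
  next
    case (B_yrs a)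
    then show ?thesis
      using balanced_pair[OF m, of "- int a"] y_elem_rs_eq[OF m, of a] by (simp only: add.commute diff_minus_eq_add)
  qed
qed

text \<open>The basis element whose support contains the given group element; \<open>y\<^sub>i rs = y\<^sub>-\<^sub>i\<close> accounts for the
  exponents above \<open>m / 2\<close>.\<close>

fun basis_index_of :: "nat \<Rightarrow> dih \<Rightarrow> basis_index" where
  "basis_index_of m (a, x) = (let i = (if x then (1 - a) mod int m else a) in
     if i = 0 then (if x then B_rs else B_e)
     else if 2 * i = int m then (if x then B_rk1s else B_rk)
     else if 2 * i < int m then B_y (nat i) else B_yrs (nat (int m - i)))"

lemma reflection_exponent:
  assumes m: "m \<ge> 3" and a: "0 \<le> a" "a < int m" and i: "i = (1 - a) mod int m"
  shows "0 \<le> i" "i < int m" "a = (1 - i) mod int m" "a = (if i = 0 then 1 else if i = 1 then 0 else int m + 1 - i)"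
proof -
  show 0: "0 \<le> i" "i < int m" using i m by auto
  have "(1 - i) mod int m = (1 - (1 - a)) mod int m" unfolding i by (rule mod_diff_right_eq)
  then show e: "a = (1 - i) mod int m" using a by simp
  show "a = (if i = 0 then 1 else if i = 1 then 0 else int m + 1 - i)"
  proof (cases "i \<le> 1")
    case True
    then show ?thesis using e 0 m by (cases "i = 0") auto
  next
    case False
    have "(1 - i) mod int m = (1 - i + int m) mod int m" by simp
    also have "\<dots> = 1 - i + int m" using False 0 by (intro mod_pos_pos_trivial) auto
    finally show ?thesis using e False by simp
  qed
qed

lemma basis_index_of_mem:
  assumes m: "m \<ge> 3" and g: "g \<in> carrier (dihedral m)"
  shows "basis_index_of m g \<in> basis_indices m"
proof -
  obtain a x where ax: "g = (a, x)" by (cases g)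
  define i where "i = (if x then (1 - a) mod int m else a)"
  have i: "0 \<le> i" "i < int m" using g ax m by (auto simp: i_def)
  then obtain j where j: "i = int j" using nonneg_int_cases by blast
  have jm: "j < m" using i j by simp
  have eq: "basis_index_of m g = (if j = 0 then (if x then B_rs else B_e)
     else if 2 * j = m then (if x then B_rk1s else B_rk)
     else if 2 * j < m then B_y j else B_yrs (m - j))"
    unfolding ax basis_index_of.simps Let_def i_def[symmetric] j using jm by (auto simp: nat_diff_distrib)
  have mem: "B_y a \<in> B_y ` A \<longleftrightarrow> a \<in> A" "B_yrs a \<in> B_yrs ` A \<longleftrightarrow> a \<in> A" for a A by auto
  show ?thesis
  proof (cases "even m")
    case True
    then obtain b where "m = 2 * b" by (elim evenE)
    then show ?thesis unfolding eq using jm m by (auto simp: basis_indices_def mem)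
  next
    case False
    then obtain b where "m = 2 * b + 1" by (elim oddE)
    moreover from this have "2 * j \<noteq> m" by presburger
    ultimately show ?thesis unfolding eq using jm m by (auto simp: basis_indices_def mem)
  qed
qed

lemma balanced_basis_rep:
  assumes m: "m \<ge> 3" and f: "balanced m f" and g: "g \<in> carrier (dihedral m)"
  shows "f g = f (basis_rep m (basis_index_of m g))"
proof -
  obtain a x where ax: "g = (a, x)" by (cases g)
  have a: "0 \<le> a" "a < int m" using g ax by auto
  define i where "i = (if x then (1 - a) mod int m else a)"
  have i: "0 \<le> i" "i < int m" using a m by (auto simp: i_def)
  have fl: "f (i mod int m, False) = f ((1 - i) mod int m, True)" if "i \<noteq> 0" "2 * i \<noteq> int m"
  proof -
    have "\<not> int m dvd 2 * i"
    proof
      assume "int m dvd 2 * i"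
      then obtain q where q: "2 * i = int m * q" by (elim dvdE)
      have "0 < int m * q" using q i that by linarith
      then have "0 < q" using m by (simp add: zero_less_mult_iff)
      moreover have "q < 2"
      proof (rule ccontr)
        assume "\<not> q < 2"
        then have "int m * 2 \<le> int m * q" by (intro mult_left_mono) auto
        then show False using q i by linarith
      qed
      ultimately have "q = 1" by simp
      then show False using q that by simp
    qed
    then show ?thesis using f by (simp add: balanced_def)
  qed
  have eq: "basis_index_of m g = (if i = 0 then (if x then B_rs else B_e)
     else if 2 * i = int m then (if x then B_rk1s else B_rk)
     else if 2 * i < int m then B_y (nat i) else B_yrs (nat (int m - i)))"
    unfolding ax basis_index_of.simps Let_def i_def[symmetric] by simp
  have half: "int (m div 2) = i" if "2 * i = int m" using that by linarith
  show ?thesis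
  proof (cases x)
    case False
    have ai: "a = i" using False by (simp add: i_def)
    have refl: "(1 - i) mod int m = int m - i + 1" if "i \<ge> 2"
    proof -
      have "(1 - i) mod int m = (1 - i + int m) mod int m" by simp
      also have "\<dots> = 1 - i + int m" using that i by (intro mod_pos_pos_trivial) auto
      finally show ?thesis by simp
    qed
    show ?thesis unfolding eq unfolding ax ai using False i half fl refl m by (auto simp: not_less)
  next
    case True
    have r: "a = (1 - i) mod int m" "a = (if i = 0 then 1 else if i = 1 then 0 else int m + 1 - i)"
      using reflection_exponent[OF m a, of i] True by (auto simp: i_def)
    show ?thesis
    proof (cases "i \<noteq> 0 \<and> 2 * i < int m")
      case True
      then have "f (i, False) = f (a, True)" using fl r(1) i by simp
      then show ?thesis unfolding eq unfolding ax using True \<open>x\<close> i by simp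
    next
      case False
      then consider "i = 0" | "i > 0" "2 * i = int m" | "i > 0" "int m < 2 * i" using i by linarith
      then show ?thesis
      proof cases
        case 1
        then show ?thesis unfolding eq unfolding ax using \<open>x\<close> r(2) by simp
      next
        case 2
        then have "a = int (m div 2) + 1" using r(2) half m by auto
        then show ?thesis unfolding eq using ax 2 \<open>x\<close> by simp
      next
        case 3
        then have "a = int (nat (int m - i)) + 1" using r(2) i m by auto
        then show ?thesis unfolding eq using ax 3 \<open>x\<close> by simp
      qed
    qed
  qed
qed

text \<open>The basis elements are the indicator functions of the blocks of a partition of the group.\<close>

lemma basis_elem_eq:
  assumes m: "m \<ge> 3" and g: "g \<in> carrier (dihedral m)" and j: "j \<in> basis_indices m"
  shows "basis_elem m j g = (if basis_index_of m g = j then 1 else 0)"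
  using balanced_basis_rep[OF m basis_elem_balanced[OF m j] g]
    basis_elem_basis_rep[OF m basis_index_of_mem[OF m g] j] by simp

lemma Q_alg_iff:
  assumes m: "m \<ge> 3"
  shows "f \<in> Q_alg m \<longleftrightarrow> balanced m f"
proof
  assume "f \<in> Q_alg m"
  then obtain c where c: "f = basis_comb m c" by (auto simp: Q_alg_def)
  show "balanced m f"
    unfolding balanced_def c basis_comb_def
    using basis_elem_balanced[OF m] by (auto simp: balanced_def intro!: sum.neutral sum.cong)
next
  assume f: "balanced m f"
  have "f = basis_comb m (\<lambda>i. f (basis_rep m i))"
  proof
    fix g
    show "f g = basis_comb m (\<lambda>i. f (basis_rep m i)) g"
    proof (cases "g \<in> carrier (dihedral m)")
      case True
      have "basis_comb m (\<lambda>i. f (basis_rep m i)) g =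
          (\<Sum>i\<in>basis_indices m. if i = basis_index_of m g then f (basis_rep m i) else 0)"
        unfolding basis_comb_def by (rule sum.cong) (auto simp: basis_elem_eq[OF m True])
      then show ?thesis
        using balanced_basis_rep[OF m f True] basis_index_of_mem[OF m True] by simp
    next
      case False
      then have "f g = 0" using f unfolding balanced_def by blast
      moreover have "basis_elem m j g = 0" if "j \<in> basis_indices m" for j
        using basis_elem_balanced[OF m that] False unfolding balanced_def by blast
      ultimately show ?thesis by (simp add: basis_comb_def)
    qed
  qed
  then show "f \<in> Q_alg m" unfolding Q_alg_def by blast
qed

lemma basis_comb_supp:
  assumes m: "m \<ge> 3" and i: "i \<in> basis_indices m" and s: "s \<in> supp (basis_elem m i)"
  shows "basis_comb m c s = c i"
proof -
  have s': "s \<in> carrier (dihedral m)"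
    using s basis_elem_balanced[OF m i] unfolding supp_def balanced_def by blast
  have "basis_index_of m s = i" using s basis_elem_eq[OF m s' i] by (auto simp: supp_def split: if_splits)
  then have "basis_comb m c s = (\<Sum>j\<in>basis_indices m. if j = i then c j else 0)"
    unfolding basis_comb_def by (intro sum.cong) (auto simp: basis_elem_eq[OF m s'])
  then show ?thesis using i by simp
qed

lemma finite_group_dihedral: "m \<ge> 3 \<Longrightarrow> finite_group (dihedral m)"
  by (intro finite_group.intro finite_group_axioms.intro group_dihedral) simp_all

lemma dihedral_inv:
  assumes m: "m \<ge> 3" and a: "0 \<le> a" "a < int m"
  shows "inv\<^bsub>dihedral m\<^esub> (a, x) = (if x then (a, True) else ((- a) mod int m, False))"
proof -
  interpret Group.group "dihedral m" by (rule group_dihedral[OF m])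
  show ?thesis by (rule inv_equality) (use m a in \<open>auto simp: mod_simps\<close>)
qed

text \<open>Pairs \<open>r\<^sup>i\<close> with \<open>r\<^sup>1\<^sup>-\<^sup>i s\<close>, as in \<open>y\<^sub>i\<close>.\<close>

lemma sum_dihedral:
  assumes m: "m \<ge> 3"
  shows "(\<Sum>u\<in>carrier (dihedral m). F u) =
    (\<Sum>i\<in>{0..<int m}. F (i, False) + F ((1 - i) mod int m, True) :: 'b :: comm_monoid_add)"
proof -
  have "(\<Sum>u\<in>carrier (dihedral m). F u) = (\<Sum>i\<in>{0..<int m}. \<Sum>x\<in>UNIV. F (i, x))"
    by (simp add: sum.cartesian_product)
  also have "\<dots> = (\<Sum>i\<in>{0..<int m}. F (i, False)) + (\<Sum>i\<in>{0..<int m}. F (i, True))"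
    by (simp add: UNIV_bool sum.distrib add.commute)
  also have "(\<Sum>i\<in>{0..<int m}. F (i, True)) = (\<Sum>i\<in>{0..<int m}. F ((1 - i) mod int m, True))"
    by (rule sum.reindex_bij_witness[of _ "\<lambda>i. (1 - i) mod int m" "\<lambda>i. (1 - i) mod int m"])
      (use m in \<open>auto simp: mod_diff_right_eq\<close>)
  finally show ?thesis by (simp add: sum.distrib)
qed

text \<open>For \<open>f\<close> let \<open>\<Delta>\<^sub>f(i)\<close> be the coefficient of \<open>r\<^sup>i\<close> minus that of \<open>r\<^sup>1\<^sup>-\<^sup>i s\<close>. Membership in \<open>Q\<close>
  says that \<open>\<Delta>\<^sub>f\<close> is supported on the subgroup of all \<open>i\<close> with \<open>2 i \<equiv> 0\<close>, and on \<open>Q\<close> the map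
  \<open>f \<mapsto> \<Delta>\<^sub>f\<close> turns products into cyclic convolutions, which preserve this support.\<close>

lemma Q_alg_mult_closed:
  assumes m: "m \<ge> 3" and f: "f \<in> Q_alg m" and h: "h \<in> Q_alg m"
  shows "ga_mult (dihedral m) f h \<in> Q_alg m"
  unfolding Q_alg_iff[OF m] balanced_def
proof (intro conjI allI impI)
  interpret finite_group "dihedral m" by (rule finite_group_dihedral[OF m])
  show "ga_mult (dihedral m) f h g = 0" if "g \<notin> carrier (dihedral m)" for g
    using that by (rule ga_mult_outside)
  fix j assume j: "\<not> int m dvd 2 * j"
  have fq: "f (i, False) = f ((1 - i) mod int m, True)" if "\<not> int m dvd 2 * i" "0 \<le> i" "i < int m" for i
    using f that unfolding Q_alg_iff[OF m] balanced_def by (metis mod_pos_pos_trivial)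
  have hq: "h (i mod int m, False) = h ((1 - i) mod int m, True)" if "\<not> int m dvd 2 * i" for i
    using h that unfolding Q_alg_iff[OF m] balanced_def by blast
  have car: "(j mod int m, False) \<in> carrier (dihedral m)" "((1 - j) mod int m, True) \<in> carrier (dihedral m)"
    using m by auto
  have "ga_mult (dihedral m) f h (j mod int m, False) - ga_mult (dihedral m) f h ((1 - j) mod int m, True) =
     (\<Sum>i\<in>{0..<int m}. (f (i, False) - f ((1 - i) mod int m, True)) *
        (h ((j - i) mod int m, False) - h ((1 - i - j) mod int m, True)))"
    unfolding ga_mult_eq[OF car(1)] ga_mult_eq[OF car(2)] sum_dihedral[OF m] sum_subtractf[symmetric]
  proof (rule sum.cong)
    fix i assume i: "i \<in> {0..<int m}"
    have shift: "- i + j = j - i" "- i + (1 - j) = 1 - i - j" "1 - i - (1 - j) = j - i" "1 - j - i = 1 - i - j" by simp_all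
    have inv: "inv\<^bsub>dihedral m\<^esub> (i, False) = ((- i) mod int m, False)"
      "inv\<^bsub>dihedral m\<^esub> ((1 - i) mod int m, True) = ((1 - i) mod int m, True)"
      using i m by (simp_all add: dihedral_inv[OF m])
    have e: "inv\<^bsub>dihedral m\<^esub> (i, False) \<otimes>\<^bsub>dihedral m\<^esub> (j mod int m, False) = ((j - i) mod int m, False)"
      "inv\<^bsub>dihedral m\<^esub> (i, False) \<otimes>\<^bsub>dihedral m\<^esub> ((1 - j) mod int m, True) = ((1 - i - j) mod int m, True)"
      "inv\<^bsub>dihedral m\<^esub> ((1 - i) mod int m, True) \<otimes>\<^bsub>dihedral m\<^esub> (j mod int m, False) = ((1 - i - j) mod int m, True)"
      "inv\<^bsub>dihedral m\<^esub> ((1 - i) mod int m, True) \<otimes>\<^bsub>dihedral m\<^esub> ((1 - j) mod int m, True) = ((j - i) mod int m, False)"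
      unfolding inv dihedral_simps by (simp_all add: mod_simps shift)
    show "f (i, False) * h (inv\<^bsub>dihedral m\<^esub> (i, False) \<otimes>\<^bsub>dihedral m\<^esub> (j mod int m, False)) +
        f ((1 - i) mod int m, True) * h (inv\<^bsub>dihedral m\<^esub> ((1 - i) mod int m, True) \<otimes>\<^bsub>dihedral m\<^esub> (j mod int m, False)) -
        (f (i, False) * h (inv\<^bsub>dihedral m\<^esub> (i, False) \<otimes>\<^bsub>dihedral m\<^esub> ((1 - j) mod int m, True)) +
        f ((1 - i) mod int m, True) * h (inv\<^bsub>dihedral m\<^esub> ((1 - i) mod int m, True) \<otimes>\<^bsub>dihedral m\<^esub> ((1 - j) mod int m, True))) =
      (f (i, False) - f ((1 - i) mod int m, True)) * (h ((j - i) mod int m, False) - h ((1 - i - j) mod int m, True))"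
      unfolding e by (simp add: algebra_simps)
  qed simp
  also have "\<dots> = 0"
  proof (rule sum.neutral, rule ballI)
    fix i assume i: "i \<in> {0..<int m}"
    show "(f (i, False) - f ((1 - i) mod int m, True)) *
        (h ((j - i) mod int m, False) - h ((1 - i - j) mod int m, True)) = 0"
    proof (cases "int m dvd 2 * i")
      case False
      then show ?thesis using fq[OF False] i by simp
    next
      case True
      have "\<not> int m dvd 2 * (j - i)"
      proof
        assume "int m dvd 2 * (j - i)"
        then have "int m dvd 2 * (j - i) + 2 * i" using True by (rule dvd_add)
        then show False using j by simp
      qed
      moreover have "(1 - (j - i)) mod int m = (1 - i - j) mod int m"
        unfolding mod_eq_dvd_iff using True by simp
      ultimately show ?thesis using hq[of "j - i"] by simp
    qed
  qed
  finally show "ga_mult (dihedral m) f h (j mod int m, False) = ga_mult (dihedral m) f h ((1 - j) mod int m, True)"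
    by simp
qed

section \<open>The map \<open>\<theta>\<close> is multiplicative\<close>

definition unity_root :: "nat \<Rightarrow> int \<Rightarrow> complex" where
  "unity_root m k = cis (2 * pi * of_int k / of_nat m)"

lemma unity_root_add: "unity_root m (k + l) = unity_root m k * unity_root m l"
  by (simp add: unity_root_def cis_mult ring_distribs add_divide_distrib)

lemma unity_root_0 [simp]: "unity_root m 0 = 1"
  by (simp add: unity_root_def)

lemma unity_root_eq_1_iff:
  assumes "m > 0" shows "unity_root m k = 1 \<longleftrightarrow> int m dvd k"
proof
  assume "unity_root m k = 1"
  then have "cos (2 * pi * of_int k / of_nat m) = 1"
    by (simp add: unity_root_def complex_eq_iff)
  then obtain q :: int where q: "2 * pi * of_int k / of_nat m = of_int q * 2 * pi"
    using cos_one_2pi_int by blast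
  have "2 * pi * of_int k = (of_int q * 2 * pi) * real m"
    using q assms by (simp add: field_simps)
  then have "real_of_int k = real_of_int (q * int m)" by simp
  then have "k = q * int m" by (simp only: of_int_eq_iff)
  then show "int m dvd k" by simp
next
  assume "int m dvd k"
  then obtain q where "k = int m * q" by (elim dvdE)
  then have "2 * pi * of_int k / of_nat m = 2 * pi * of_int q"
    using assms by (simp add: field_simps)
  then show "unity_root m k = 1"
    unfolding unity_root_def by (simp only:) (simp add: cis_multiple_2pi)
qed

lemma unity_root_cong:
  assumes "m > 0" "int m dvd k - l"
  shows "unity_root m k = unity_root m l"
  using unity_root_add[of m l "k - l"] unity_root_eq_1_iff[of m "k - l"] assms by simp

lemma unity_root_mult_mod:
  assumes "m > 0"
  shows "unity_root m (a * (i mod int m)) = unity_root m (a * i)"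
proof (rule unity_root_cong[OF assms])
  have "int m dvd i mod int m - i" by (simp add: mod_eq_dvd_iff[symmetric])
  then have "int m dvd a * (i mod int m - i)" by (rule dvd_mult)
  then show "int m dvd a * (i mod int m) - a * i" by (simp add: right_diff_distrib)
qed

lemma unity_root_half:
  assumes "even m" "m > 0"
  shows "unity_root m (a * int (m div 2)) = (- 1) powi a"
proof -
  have half: "real (m div 2) = real m / 2" using assms by (simp add: real_of_nat_div)
  have "2 * pi * of_int (a * int (m div 2)) / of_nat m = of_int a * pi"
    using assms by (simp only: of_int_mult of_int_of_nat_eq half) simp
  then have "unity_root m (a * int (m div 2)) = cis pi powi a"
    unfolding unity_root_def using cis_power_int[of pi a] by (simp only:)
  then show ?thesis by simp
qed

lemma unity_root_sum:
  "unity_root m k + unity_root m (- k) = of_real (2 * cos (2 * pi * of_int k / of_nat m))"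
  by (simp add: unity_root_def complex_eq_iff)

text \<open>In the two-dimensional module where \<open>r\<close> acts by \<open>\<zeta>\<^sup>a, \<zeta>\<^sup>-\<^sup>a\<close> on \<open>v\<^sub>+, v\<^sub>-\<close> and \<open>rs\<close> exchanges
  them, this is the \<open>v\<^sub>+\<close>-coordinate of \<open>g (v\<^sub>+ + v\<^sub>-)\<close>.\<close>

definition rot_functional :: "nat \<Rightarrow> int \<Rightarrow> dih \<Rightarrow> complex" where
  "rot_functional m a = (\<lambda>(i, x). unity_root m (if x then a * (i - 1) else a * i))"

text \<open>In the same module, the value of \<open>v\<^sub>+\<^sup>* - v\<^sub>-\<^sup>*\<close> at \<open>g v\<^sub>+\<close>.\<close>

definition refl_functional :: "nat \<Rightarrow> int \<Rightarrow> dih \<Rightarrow> complex" where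
  "refl_functional m a = (\<lambda>(i, x). if x then - unity_root m (a * (1 - i)) else unity_root m (a * i))"

lemma sum_ga_elem:
  assumes "finite A" "g \<in> A"
  shows "(\<Sum>u\<in>A. complex_of_real (ga_elem g u) * L u) = L g"
proof -
  have "(\<Sum>u\<in>A. complex_of_real (ga_elem g u) * L u) = (\<Sum>u\<in>A. if u = g then L u else 0)"
    by (rule sum.cong) (auto simp: ga_elem_def)
  then show ?thesis using assms by simp
qed

text \<open>The two terms of \<open>y\<^sub>i\<close> contribute \<open>\<zeta>\<^sup>a\<^sup>i\<close> and \<open>\<zeta>\<^sup>-\<^sup>a\<^sup>i\<close> to the first sum, which add up to twice a
  cosine, and \<open>\<zeta>\<^sup>a\<^sup>i\<close> and \<open>- \<zeta>\<^sup>a\<^sup>i\<close> to the second, which cancel.\<close>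

lemma functional_basis_elem:
  assumes m: "m \<ge> 3" and j: "j \<in> basis_indices m"
  shows "(\<Sum>u\<in>carrier (dihedral m). complex_of_real (basis_elem m j u) * rot_functional m a u) = basis_char m j (a, False)"
    and "(\<Sum>u\<in>carrier (dihedral m). complex_of_real (basis_elem m j u) * refl_functional m a u) = basis_char m j (a, True)"
proof -
  have m0: "m > 0" using m by simp
  have in_carrier: "(x mod int m, b) \<in> carrier (dihedral m)" for x b
    using m by simp
  have single: "(\<Sum>u\<in>carrier (dihedral m). complex_of_real (ga_elem (x mod int m, b) u) * L u) = L (x mod int m, b)"
    for x b and L :: "dih \<Rightarrow> complex"
    by (rule sum_ga_elem) (use in_carrier in auto)
  have double: "(\<Sum>u\<in>carrier (dihedral m). complex_of_real (ga_elem (x mod int m, b) u + ga_elem (y mod int m, c) u) * L u)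
      = L (x mod int m, b) + L (y mod int m, c)" for x b y c and L :: "dih \<Rightarrow> complex"
    by (simp only: of_real_add distrib_right sum.distrib single)
  have rm: "rot_functional m a (x mod int m, b) = rot_functional m a (x, b)" for x b
    using unity_root_mult_mod[OF m0, of a x] unity_root_cong[OF m0, of "a * (x mod int m - 1)" "a * (x - 1)"]
      mod_eq_dvd_iff[of "x mod int m" "int m" x] dvd_mult[of "int m" "x mod int m - x" a]
    by (auto simp: rot_functional_def right_diff_distrib)
  have fm: "refl_functional m a (x mod int m, b) = refl_functional m a (x, b)" for x b
    using unity_root_mult_mod[OF m0, of a x] unity_root_cong[OF m0, of "a * (1 - x)" "a * (1 - x mod int m)"]
      mod_eq_dvd_iff[of "x mod int m" "int m" x] dvd_mult[of "int m" "x mod int m - x" a]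
    by (auto simp: refl_functional_def right_diff_distrib)
  have minus: "- (a * i) = a * (- i)" for i by simp
  have half: "unity_root m (a * int (m div 2)) = (- 1) powi a" if "even m"
    by (rule unity_root_half[OF that m0])
  have half': "unity_root m (- (a * int (m div 2))) = (- 1) powi a" if "even m"
    using unity_root_half[OF that m0, of "- a"] by (simp add: power_int_minus power_int_inverse[symmetric])
  have two: "unity_root m (a * int i) + unity_root m (- (a * int i)) = chi_two m i (a, False)" for i
    unfolding unity_root_sum chi_two_def by (simp add: mult_ac)
  have "(\<Sum>u\<in>carrier (dihedral m). complex_of_real (basis_elem m j u) * rot_functional m a u) = basis_char m j (a, False) \<and>
    (\<Sum>u\<in>carrier (dihedral m). complex_of_real (basis_elem m j u) * refl_functional m a u) = basis_char m j (a, True)"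
  proof (cases j)
    case B_e
    have e: "basis_elem m j = ga_elem (0 mod int m, False)" using B_e by simp
    show ?thesis unfolding e single rm fm using B_e
      by (simp add: rot_functional_def refl_functional_def chi_id_def)
  next
    case B_rs
    have e: "basis_elem m j = ga_elem (1 mod int m, True)" using B_rs by (simp add: dih_r_def dih_s_def)
    show ?thesis unfolding e single rm fm using B_rs
      by (simp add: rot_functional_def refl_functional_def chi_eps_def)
  next
    case B_rk
    then have ev: "even m" using j by (auto simp: basis_indices_def split: if_splits)
    have e: "basis_elem m j = ga_elem (int (m div 2) mod int m, False)"
      using B_rk by (simp add: dih_r_pow_nat[OF m])
    show ?thesis unfolding e single rm fm using B_rk half[OF ev]
      by (simp add: rot_functional_def refl_functional_def chi_gamma_def)
  next
    case B_rk1s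
    then have ev: "even m" using j by (auto simp: basis_indices_def split: if_splits)
    have e: "basis_elem m j = ga_elem ((int (m div 2) + 1) mod int m, True)"
      using B_rk1s by (simp only: basis_elem.simps dih_r_pow_nat[OF m] dih_s_def) (simp add: add.commute)
    show ?thesis unfolding e single rm fm using B_rk1s half[OF ev] half'[OF ev]
      by (simp add: rot_functional_def refl_functional_def chi_gamma_def chi_eps_def)
  next
    case (B_y i)
    then show ?thesis unfolding B_y basis_elem.simps y_elem_eq[OF m] double rm fm
      using two[of i] by (simp add: rot_functional_def refl_functional_def chi_two_def add.commute)
  next
    case (B_yrs i)
    then show ?thesis unfolding B_yrs y_elem_rs_eq[OF m] double rm fm
      using two[of i] by (simp add: rot_functional_def refl_functional_def chi_two_def add.commute)
  qed
  then show "(\<Sum>u\<in>carrier (dihedral m). complex_of_real (basis_elem m j u) * rot_functional m a u) = basis_char m j (a, False)"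
    "(\<Sum>u\<in>carrier (dihedral m). complex_of_real (basis_elem m j u) * refl_functional m a u) = basis_char m j (a, True)"
    by blast+
qed

lemma theta_functional:
  assumes m: "m \<ge> 3" and f: "f \<in> Q_alg m"
  shows "theta m f (a, False) = (\<Sum>u\<in>carrier (dihedral m). complex_of_real (f u) * rot_functional m a u)"
    and "theta m f (a, True) = (\<Sum>u\<in>carrier (dihedral m). complex_of_real (f u) * refl_functional m a u)"
proof -
  obtain c where c: "f = basis_comb m c" using f by (auto simp: Q_alg_def)
  have "(\<Sum>u\<in>carrier (dihedral m). complex_of_real (f u) * L u) =
      (\<Sum>j\<in>basis_indices m. complex_of_real (c j) * (\<Sum>u\<in>carrier (dihedral m). complex_of_real (basis_elem m j u) * L u))"
    for L :: "dih \<Rightarrow> complex"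
    unfolding c basis_comb_def of_real_sum sum_distrib_right sum_distrib_left
    by (subst sum.swap) (simp only: of_real_mult mult.assoc)
  note comb = this
  show "theta m f (a, False) = (\<Sum>u\<in>carrier (dihedral m). complex_of_real (f u) * rot_functional m a u)"
    unfolding comb unfolding c theta_comb[OF m]
    by (rule sum.cong) (simp_all only: functional_basis_elem(1)[OF m])
  show "theta m f (a, True) = (\<Sum>u\<in>carrier (dihedral m). complex_of_real (f u) * refl_functional m a u)"
    unfolding comb unfolding c theta_comb[OF m]
    by (rule sum.cong) (simp_all only: functional_basis_elem(2)[OF m])
qed

lemma basis_char_even:
  "basis_char m j (- a, x) = basis_char m j (a, x)"
proof -
  have "(- 1 :: complex) powi (- a) = (- 1) powi a"
    by (simp add: power_int_minus power_int_inverse[symmetric])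
  then show ?thesis
    by (cases j) (auto simp: chi_id_def chi_eps_def chi_gamma_def chi_two_def)
qed

text \<open>Replacing \<open>a\<close> by \<open>- a\<close> exchanges \<open>v\<^sub>+\<close> and \<open>v\<^sub>-\<close>. That \<open>\<theta>(f)\<close> takes the same value at both
  says that the two coordinates give the same eigenvalue, so \<open>v\<^sub>+ + v\<^sub>-\<close> really is an eigenvector.\<close>

lemma theta_even: "theta m f (- a, x) = theta m f (a, x)"
  by (simp add: theta_def basis_char_even)

text \<open>A rotation or reflection \<open>u\<close> sends the coordinate form of \<open>v\<^sub>+\<close> to a multiple of that of \<open>v\<^sub>+\<close> or
  \<open>v\<^sub>-\<close>, respectively; by the symmetry \<open>a \<mapsto> - a\<close> both of them evaluate \<open>h (v\<^sub>+ + v\<^sub>-)\<close> to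
  \<open>\<theta>(h)(r\<^sup>a)\<close>. At reflections the roles of the two factors are exchanged.\<close>

lemma theta_mult:
  assumes m: "m \<ge> 3" and f: "f \<in> Q_alg m" and h: "h \<in> Q_alg m"
  shows "theta m (ga_mult (dihedral m) f h) g = theta m f g * theta m h g"
proof -
  interpret finite_group "dihedral m" by (rule finite_group_dihedral[OF m])
  have m0: "m > 0" using m by simp
  let ?C = "carrier (dihedral m)"
  obtain a x where g: "g = (a, x)" by (cases g)
  note fh = Q_alg_mult_closed[OF m f h]
  have cong: "unity_root m (k * (i mod int m) - l) = unity_root m (k * i - l)"
    "unity_root m (l - k * (i mod int m)) = unity_root m (l - k * i)" for k i l
    using unity_root_add[of m "k * (i mod int m)" "- l"] unity_root_add[of m "k * i" "- l"]
      unity_root_add[of m l "- k * (i mod int m)"] unity_root_add[of m l "- k * i"]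
      unity_root_mult_mod[OF m0, of k i] unity_root_mult_mod[OF m0, of "- k" i] by simp_all
  show ?thesis
  proof (cases x)
    case False
    have mult: "rot_functional m a (u \<otimes>\<^bsub>dihedral m\<^esub> v) =
        rot_functional m a u * rot_functional m (if snd u then - a else a) v" for u v
    proof -
      obtain i y j z where uv: "u = (i, y)" "v = (j, z)" by (cases u, cases v)
      show ?thesis
        unfolding uv by (cases y; cases z;
          simp add: rot_functional_def right_diff_distrib distrib_left cong unity_root_mult_mod[OF m0] unity_root_add[symmetric];
          simp add: algebra_simps)
    qed
    have sumv: "(\<Sum>v\<in>?C. complex_of_real (h v) * rot_functional m (if snd u then - a else a) v) = theta m h (a, False)" for u
      using theta_functional(1)[OF m h, of a] theta_functional(1)[OF m h, of "- a"] theta_even[of m h a False] by simp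
    have "theta m (ga_mult (dihedral m) f h) (a, False) =
        (\<Sum>u\<in>?C. \<Sum>v\<in>?C. complex_of_real (f u) * of_real (h v) * rot_functional m a (u \<otimes>\<^bsub>dihedral m\<^esub> v))"
      unfolding theta_functional(1)[OF m fh] sum_ga_mult ..
    also have "\<dots> = (\<Sum>u\<in>?C. (complex_of_real (f u) * rot_functional m a u) *
        (\<Sum>v\<in>?C. complex_of_real (h v) * rot_functional m (if snd u then - a else a) v))"
      unfolding mult sum_distrib_left by (simp only: mult_ac)
    also have "\<dots> = theta m f (a, False) * theta m h (a, False)"
      unfolding sumv theta_functional(1)[OF m f] sum_distrib_right ..
    finally show ?thesis using g False by simp
  next
    case True
    have mult: "refl_functional m a (u \<otimes>\<^bsub>dihedral m\<^esub> v) =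
        refl_functional m (if snd v then - a else a) u * refl_functional m a v" for u v
    proof -
      obtain i y j z where uv: "u = (i, y)" "v = (j, z)" by (cases u, cases v)
      show ?thesis
        unfolding uv by (cases y; cases z;
          simp add: refl_functional_def right_diff_distrib distrib_left cong unity_root_mult_mod[OF m0] unity_root_add[symmetric];
          simp add: algebra_simps)
    qed
    have sumu: "(\<Sum>u\<in>?C. complex_of_real (f u) * refl_functional m (if snd v then - a else a) u) = theta m f (a, True)" for v
      using theta_functional(2)[OF m f, of a] theta_functional(2)[OF m f, of "- a"] theta_even[of m f a True] by simp
    have "theta m (ga_mult (dihedral m) f h) (a, True) =
        (\<Sum>v\<in>?C. \<Sum>u\<in>?C. complex_of_real (f u) * of_real (h v) * refl_functional m a (u \<otimes>\<^bsub>dihedral m\<^esub> v))"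
      unfolding theta_functional(2)[OF m fh] sum_ga_mult by (rule sum.swap)
    also have "\<dots> = (\<Sum>v\<in>?C. (\<Sum>u\<in>?C. complex_of_real (f u) * refl_functional m (if snd v then - a else a) u) *
        (complex_of_real (h v) * refl_functional m a v))"
      unfolding mult sum_distrib_right by (simp only: mult_ac)
    also have "\<dots> = theta m f (a, True) * theta m h (a, True)"
      unfolding sumu theta_functional(2)[OF m h] sum_distrib_left ..
    finally show ?thesis using g True by simp
  qed
qed

lemma word_sum_Q_alg:
  assumes m: "m \<ge> 3" and f: "f \<in> Q_alg m"
  shows "word_sum (dihedral m) f d \<in> Q_alg m \<and> (\<forall>g\<in>carrier (dihedral m). theta m (word_sum (dihedral m) f d) g = theta m f g ^ d)"
proof (induction d)
  case 0
  have e: "B_e \<in> basis_indices m" by (simp add: basis_indices_def)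
  have "word_sum (dihedral m) f 0 = basis_elem m B_e" by (simp add: word_sum_0)
  then show ?case
    using theta_basis_elem[OF m e] basis_elem_balanced[OF m e] by (simp add: Q_alg_iff[OF m] chi_id_def)
next
  case (Suc d)
  interpret finite_group "dihedral m" by (rule finite_group_dihedral[OF m])
  have "supp f \<subseteq> carrier (dihedral m)"
    using f unfolding Q_alg_iff[OF m] balanced_def supp_def by blast
  then have "word_sum (dihedral m) f (Suc d) = ga_mult (dihedral m) f (word_sum (dihedral m) f d)"
    by (rule word_sum_Suc)
  then show ?case
    using Q_alg_mult_closed[OF m f] theta_mult[OF m f] Suc by simp
qed

section \<open>Simple modules realising the characters\<close>

lemma one_dim_simple:
  assumes G: "Group.group G" and c1: "c \<one>\<^bsub>G\<^esub> = (1 :: complex)"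
    and mult: "\<And>g h. g \<in> carrier G \<Longrightarrow> h \<in> carrier G \<Longrightarrow> c (g \<otimes>\<^bsub>G\<^esub> h) = c g * c h"
  shows "simple_rep G 1 (\<lambda>g. mat 1 1 (\<lambda>_. c g))" "rep_char (\<lambda>g. mat 1 1 (\<lambda>_. c g)) = c"
proof -
  show "rep_char (\<lambda>g. mat 1 1 (\<lambda>_. c g)) = c" by (rule ext) (simp add: rep_char_def)
  have "mat_rep G 1 (\<lambda>g. mat 1 1 (\<lambda>_. c g))"
    unfolding mat_rep_def using c1 mult by (auto simp: scalar_prod_def intro!: eq_matI)
  moreover have "W = {0\<^sub>v 1} \<or> W = carrier_vec 1"
    if "subspace class_ring W (module_vec TYPE(complex) 1)" for W
  proof (cases "W \<subseteq> {0\<^sub>v 1}")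
    case True
    then show ?thesis using that unfolding subspace_iff by blast
  next
    case False
    then obtain v where v: "v \<in> W" "v \<noteq> 0\<^sub>v 1" by blast
    have vc: "v \<in> carrier_vec 1" using v that unfolding subspace_iff by blast
    have v0: "v $ 0 \<noteq> 0"
    proof
      assume "v $ 0 = 0"
      then have "v = 0\<^sub>v 1" using vc by (intro eq_vecI) auto
      then show False using v by simp
    qed
    have "w \<in> W" if w: "w \<in> carrier_vec 1" for w
    proof -
      have "w = (w $ 0 / v $ 0) \<cdot>\<^sub>v v" using w vc v0 by (intro eq_vecI) auto
      then show ?thesis using v \<open>subspace class_ring W _\<close> unfolding subspace_iff by metis
    qed
    then show ?thesis using that unfolding subspace_iff by blast
  qed
  ultimately show "simple_rep G 1 (\<lambda>g. mat 1 1 (\<lambda>_. c g))"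
    unfolding simple_rep_def submodule_of_def by auto
qed

text \<open>The rotation \<open>r\<close> acts by \<open>diag(\<zeta>\<^sup>j, \<zeta>\<^sup>-\<^sup>j)\<close> and \<open>s\<close> exchanges the two coordinates.\<close>

definition two_dim_rep :: "nat \<Rightarrow> nat \<Rightarrow> dih \<Rightarrow> complex mat" where
  "two_dim_rep m j = (\<lambda>(a, x). mat 2 2 (\<lambda>(p, q). if (p \<noteq> q) = x
     then unity_root m (if p = 0 then int j * a else - (int j * a)) else 0))"

lemma two_dim_rep_char: "rep_char (two_dim_rep m j) = chi_two m j"
proof
  fix g :: dih
  obtain a x where g: "g = (a, x)" by (cases g)
  have "rep_char (two_dim_rep m j) g = (if x then 0 else unity_root m (int j * a) + unity_root m (- (int j * a)))"
    unfolding g by (simp add: rep_char_def two_dim_rep_def lessThan_Suc numeral_2_eq_2)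
  then show "rep_char (two_dim_rep m j) g = chi_two m j g"
    unfolding g unity_root_sum chi_two_def by (simp add: mult_ac)
qed

lemma two_dim_rep_mat_rep:
  assumes m: "m \<ge> 3"
  shows "mat_rep (dihedral m) 2 (two_dim_rep m j)"
  unfolding mat_rep_def
proof (intro conjI ballI)
  have m0: "m > 0" using m by simp
  show "two_dim_rep m j g \<in> carrier_mat 2 2" for g by (cases g) (simp add: two_dim_rep_def)
  show "two_dim_rep m j \<one>\<^bsub>dihedral m\<^esub> = 1\<^sub>m 2"
    by (intro eq_matI) (auto simp: two_dim_rep_def)
  fix g h :: dih
  obtain a x b y where gh: "g = (a, x)" "h = (b, y)" by (cases g, cases h)
  have red: "unity_root m (int j * (k mod int m)) = unity_root m (int j * k)"
    "unity_root m (- (int j * (k mod int m))) = unity_root m (- (int j * k))" for k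
    using unity_root_mult_mod[OF m0, of "int j" k] unity_root_mult_mod[OF m0, of "- int j" k] by simp_all
  show "two_dim_rep m j (g \<otimes>\<^bsub>dihedral m\<^esub> h) = two_dim_rep m j g * two_dim_rep m j h"
  proof (rule eq_matI)
    fix p q assume "p < dim_row (two_dim_rep m j g * two_dim_rep m j h)" "q < dim_col (two_dim_rep m j g * two_dim_rep m j h)"
    then have "p < 2" "q < 2" by (auto simp: gh two_dim_rep_def)
    then have pq: "p = 0 \<or> p = 1" "q = 0 \<or> q = 1" by auto
    show "two_dim_rep m j (g \<otimes>\<^bsub>dihedral m\<^esub> h) $$ (p, q) = (two_dim_rep m j g * two_dim_rep m j h) $$ (p, q)"
      using pq unfolding gh
      by (cases x; cases y)
        (auto simp: two_dim_rep_def scalar_prod_def numeral_2_eq_2 red unity_root_add[symmetric] right_diff_distrib distrib_left)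
  qed (auto simp: gh two_dim_rep_def)
qed

lemma two_dim_rep_simple:
  assumes m: "m \<ge> 3" and j: "0 < j" "2 * j < m"
  shows "simple_rep (dihedral m) 2 (two_dim_rep m j)"
proof -
  have "W = {0\<^sub>v 2} \<or> W = carrier_vec 2" if W: "submodule_of (dihedral m) 2 (two_dim_rep m j) W" for W
  proof (cases "W \<subseteq> {0\<^sub>v 2}")
    case True
    then show ?thesis using W unfolding submodule_of_def subspace_iff by blast
  next
    case False
    have sub: "W \<subseteq> carrier_vec 2" and add: "\<And>v w. v \<in> W \<Longrightarrow> w \<in> W \<Longrightarrow> v + w \<in> W"
      and sm: "\<And>c v. v \<in> W \<Longrightarrow> c \<cdot>\<^sub>v v \<in> W"
      and st: "\<And>g w. g \<in> carrier (dihedral m) \<Longrightarrow> w \<in> W \<Longrightarrow> two_dim_rep m j g *\<^sub>v w \<in> W"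
      using W unfolding submodule_of_def subspace_iff by blast+
    obtain v where v: "v \<in> W" "v \<noteq> 0\<^sub>v 2" using False by blast
    have vc: "v \<in> carrier_vec 2" using v sub by blast
    have car: "(1, False) \<in> carrier (dihedral m)" "(0, True) \<in> carrier (dihedral m)" using m by auto
    define z z' where "z = unity_root m (int j)" and "z' = unity_root m (- int j)"
    have zz: "z \<noteq> z'"
    proof
      assume "z = z'"
      then have "unity_root m (int j + int j) = unity_root m (- int j + int j)"
        unfolding unity_root_add z_def z'_def by simp
      then have "int m dvd int (2 * j)" using m by (simp add: unity_root_eq_1_iff)
      then have "m dvd 2 * j" by (simp only: int_dvd_int_iff)
      then show False using j by (auto dest: dvd_imp_le)
    qed
    have R: "two_dim_rep m j (1, False) *\<^sub>v w = vec 2 (\<lambda>p. if p = 0 then z * w $ 0 else z' * w $ 1)"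
      and S: "two_dim_rep m j (0, True) *\<^sub>v w = vec 2 (\<lambda>p. if p = 0 then w $ 1 else w $ 0)"
      if "w \<in> carrier_vec 2" for w
      using that
      by (auto intro!: eq_vecI simp: two_dim_rep_def scalar_prod_def numeral_2_eq_2 z_def z'_def less_Suc_eq)
    have e0: "unit_vec 2 0 \<in> W"
    proof (cases "v $ 0 = 0")
      case False
      \<comment> \<open>\<open>r\<close> acts by two different scalars, so the second coordinate of \<open>v\<close> can be eliminated.\<close>
      have "two_dim_rep m j (1, False) *\<^sub>v v + (- z') \<cdot>\<^sub>v v \<in> W"
        by (intro add sm st car v)
      then have "(1 / ((z - z') * v $ 0)) \<cdot>\<^sub>v (two_dim_rep m j (1, False) *\<^sub>v v + (- z') \<cdot>\<^sub>v v) \<in> W"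
        by (rule sm)
      moreover have "(1 / ((z - z') * v $ 0)) \<cdot>\<^sub>v (two_dim_rep m j (1, False) *\<^sub>v v + (- z') \<cdot>\<^sub>v v) = unit_vec 2 0"
        unfolding R[OF vc] using vc zz False
        by (intro eq_vecI) (auto simp: less_Suc_eq numeral_2_eq_2 unit_vec_def field_simps)
      ultimately show ?thesis by simp
    next
      case True
      have v1: "v $ 1 \<noteq> 0"
      proof
        assume "v $ 1 = 0"
        then have "v = 0\<^sub>v 2" using vc True by (intro eq_vecI) (auto simp: less_Suc_eq numeral_2_eq_2)
        then show False using v by simp
      qed
      have "(1 / v $ 1) \<cdot>\<^sub>v (two_dim_rep m j (0, True) *\<^sub>v v) \<in> W" by (intro sm st car v)
      moreover have "(1 / v $ 1) \<cdot>\<^sub>v (two_dim_rep m j (0, True) *\<^sub>v v) = unit_vec 2 0"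
        unfolding S[OF vc] using vc v1 True
        by (intro eq_vecI) (auto simp: less_Suc_eq numeral_2_eq_2 unit_vec_def)
      ultimately show ?thesis by simp
    qed
    have "two_dim_rep m j (0, True) *\<^sub>v unit_vec 2 0 \<in> W" by (intro st car e0)
    moreover have "two_dim_rep m j (0, True) *\<^sub>v unit_vec 2 0 = unit_vec 2 1"
      by (subst S) (auto intro!: eq_vecI simp: less_Suc_eq numeral_2_eq_2 unit_vec_def)
    ultimately have e1: "unit_vec 2 1 \<in> W" by simp
    have "w \<in> W" if w: "w \<in> carrier_vec 2" for w
    proof -
      have "w = (w $ 0) \<cdot>\<^sub>v unit_vec 2 0 + (w $ 1) \<cdot>\<^sub>v unit_vec 2 1"
        using w by (intro eq_vecI) (auto simp: less_Suc_eq numeral_2_eq_2 unit_vec_def)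
      moreover have "(w $ 0) \<cdot>\<^sub>v unit_vec 2 0 + (w $ 1) \<cdot>\<^sub>v unit_vec 2 1 \<in> W"
        by (intro add sm e0 e1)
      ultimately show ?thesis by simp
    qed
    then show ?thesis using sub by blast
  qed
  then show ?thesis unfolding simple_rep_def using two_dim_rep_mat_rep[OF m] by auto
qed

lemma chi_gamma_mult:
  assumes m: "m \<ge> 3" "even m"
  shows "chi_gamma (g \<otimes>\<^bsub>dihedral m\<^esub> h) = chi_gamma g * chi_gamma h"
proof -
  have par: "(- 1 :: complex) powi k = (if even k then 1 else - 1)" for k :: int
    by (auto simp: power_int_minus_one_minus elim!: evenE oddE)
  have "even (k mod int m) \<longleftrightarrow> even k" for k using m by (simp add: dvd_mod_iff)
  then show ?thesis
    by (cases g; cases h) (auto simp: chi_gamma_def par)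
qed

lemma chi_eps_mult: "chi_eps (g \<otimes>\<^bsub>dihedral m\<^esub> h) = chi_eps g * chi_eps h"
  by (cases g; cases h) (auto simp: chi_eps_def)

text \<open>The bounds on \<open>i\<close> in the basis elements \<open>y\<^sub>i\<close> and \<open>y\<^sub>i rs\<close> give \<open>0 < 2 i < m\<close>, so that
  \<open>\<zeta>\<^sup>i\<close> and \<open>\<zeta>\<^sup>-\<^sup>i\<close> are distinct and the two-dimensional module is simple.\<close>

lemma basis_char_simple:
  assumes m: "m \<ge> 3" and i: "i \<in> basis_indices m"
  obtains q \<pi> where "simple_rep (dihedral m) q \<pi>" "rep_char \<pi> = basis_char m i"
proof -
  note G = group_dihedral[OF m]
  have even: "even m" if "i = B_rk \<or> i = B_rk1s"
    using that i by (auto simp: basis_indices_def split: if_splits)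
  have two: thesis if "i = B_y j \<or> i = B_yrs j" for j
  proof -
    have "0 < j" "2 * j < m" using that i m by (auto simp: basis_indices_def split: if_splits elim!: evenE oddE)
    then have "simple_rep (dihedral m) 2 (two_dim_rep m j)" by (rule two_dim_rep_simple[OF m])
    then show thesis using that(1) two_dim_rep_char[of m j] \<open>\<And>q \<pi>. simple_rep (dihedral m) q \<pi> \<Longrightarrow> rep_char \<pi> = basis_char m i \<Longrightarrow> thesis\<close>
      by auto
  qed
  have one: thesis
    if "basis_char m i \<one>\<^bsub>dihedral m\<^esub> = 1"
      "\<And>g h. basis_char m i (g \<otimes>\<^bsub>dihedral m\<^esub> h) = basis_char m i g * basis_char m i h"
    using one_dim_simple[OF G, of "basis_char m i"] that(1,2)
      \<open>\<And>q \<pi>. simple_rep (dihedral m) q \<pi> \<Longrightarrow> rep_char \<pi> = basis_char m i \<Longrightarrow> thesis\<close> by blast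
  show thesis
  proof (cases i)
    case B_e
    then show thesis by (intro one) (simp_all add: chi_id_def)
  next
    case B_rs
    then show thesis using chi_eps_mult by (intro one) (simp_all add: chi_eps_def del: dihedral_simps(3))
  next
    case B_rk
    then show thesis using chi_gamma_mult[OF m even] by (intro one) (simp_all add: chi_gamma_def del: dihedral_simps(3))
  next
    case B_rk1s
    then show thesis using chi_gamma_mult[OF m even] chi_eps_mult
      by (intro one) (simp_all add: chi_gamma_def chi_eps_def del: dihedral_simps(3))
  qed (use two in auto)
qed

lemma (in finite_group) char_ip_sum:
  "char_ip (\<lambda>g. \<Sum>i\<in>I. c i * \<phi> i g) \<psi> = (\<Sum>i\<in>I. c i * char_ip (\<phi> i) \<psi>)"
proof -
  have "(\<Sum>g\<in>carrier G. (\<Sum>i\<in>I. c i * \<phi> i g) * \<psi> (inv g)) =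
      (\<Sum>i\<in>I. c i * (\<Sum>g\<in>carrier G. \<phi> i g * \<psi> (inv g)))"
    unfolding sum_distrib_right sum_distrib_left by (subst sum.swap) (simp only: mult.assoc)
  then show ?thesis by (simp only: char_ip_def times_divide_eq_right sum_divide_distrib[symmetric])
qed

theorem theorem5p4:
  fixes m n p d :: nat
    and \<rho> \<tau> :: "dih \<Rightarrow> complex mat"
    and f :: "dih \<Rightarrow> real"
    and \<sigma> :: "basis_index \<Rightarrow> dih"
  assumes "m \<ge> 3"
    and "mat_rep (dihedral m) n \<rho>"
    and "f \<in> Q_alg m"
    and "\<forall>g\<in>carrier (dihedral m). theta m f g = rep_char \<rho> g"
    and "\<forall>i\<in>basis_indices m. \<sigma> i \<in> supp (basis_elem m i)"
    and "simple_rep (dihedral m) p \<tau>"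
  shows "real (multiplicity_rep (dihedral m) \<tau> (tensor_power_rep d \<rho>)) =
    (\<Sum>i | i \<in> basis_indices m \<and>
          (\<forall>g\<in>carrier (dihedral m). theta m (basis_elem m i) g = rep_char \<tau> g).
       \<Sum>w\<in>cayley_words (dihedral m) (supp f) (\<sigma> i) d. word_weight f w)"
proof -
  note m = assms(1) and \<rho> = assms(2) and f = assms(3) and \<tau> = assms(6)
  let ?D = "dihedral m" and ?I = "basis_indices m"
  let ?J = "{i. i \<in> ?I \<and> (\<forall>g\<in>carrier ?D. theta m (basis_elem m i) g = rep_char \<tau> g)}"
  interpret finite_group ?D by (rule finite_group_dihedral[OF m])
  obtain c where c: "word_sum ?D f d = basis_comb m c"
    using word_sum_Q_alg[OF m f, of d] by (auto simp: Q_alg_def)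
  have coeff: "word_sum ?D f d (\<sigma> i) = c i" if "i \<in> ?I" for i
    unfolding c using basis_comb_supp[OF m that] assms(5) that by blast
  have ip: "char_ip (basis_char m i) (rep_char \<tau>) = (if i \<in> ?J then 1 else 0)" if i: "i \<in> ?I" for i
  proof -
    obtain q \<pi> where \<pi>: "simple_rep ?D q \<pi>" "rep_char \<pi> = basis_char m i"
      using basis_char_simple[OF m i] by blast
    have J: "i \<in> ?J \<longleftrightarrow> (\<forall>g\<in>carrier ?D. rep_char \<pi> g = rep_char \<tau> g)"
      using i \<pi>(2) theta_basis_elem[OF m i] by simp
    show ?thesis
    proof (cases "i \<in> ?J")
      case True
      then have "char_ip (rep_char \<pi>) (rep_char \<tau>) = char_ip (rep_char \<tau>) (rep_char \<tau>)"
        unfolding J by (intro char_ip_cong) auto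
      then show ?thesis using True \<pi>(2) char_ip_simple_self[OF \<tau>] by simp
    next
      case False
      have "\<not> iso_rep ?D \<pi> \<tau>"
      proof
        assume "iso_rep ?D \<pi> \<tau>"
        from rep_char_iso[OF this] have "i \<in> ?J" unfolding J by (rule ballI)
        with False show False ..
      qed
      then show ?thesis using char_ip_simple[OF \<pi>(1) \<tau>] False \<pi>(2) by simp
    qed
  qed
  have "complex_of_nat (multiplicity_rep ?D \<tau> (tensor_power_rep d \<rho>)) =
      char_ip (rep_char (tensor_power_rep d \<rho>)) (rep_char \<tau>)"
    by (rule multiplicity_char_ip[OF mat_rep_tensor_power[OF \<rho> group_dihedral[OF m]] \<tau>])
  also have "\<dots> = char_ip (\<lambda>g. \<Sum>i\<in>?I. complex_of_real (c i) * basis_char m i g) (rep_char \<tau>)"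
  proof (rule char_ip_cong)
    fix g assume g: "g \<in> carrier ?D"
    have "rep_char (tensor_power_rep d \<rho>) g = theta m f g ^ d"
      by (simp only: rep_char_tensor_power[OF \<rho> group_dihedral[OF m] g] bspec[OF assms(4) g])
    also have "\<dots> = theta m (basis_comb m c) g"
      using bspec[OF conjunct2[OF word_sum_Q_alg[OF m f, of d]] g] unfolding c by (rule sym)
    finally show "rep_char (tensor_power_rep d \<rho>) g = (\<Sum>i\<in>?I. complex_of_real (c i) * basis_char m i g)"
      by (simp add: theta_comb[OF m])
  qed simp
  also have "\<dots> = (\<Sum>i\<in>?I. if i \<in> ?J then complex_of_real (c i) else 0)"
    unfolding char_ip_sum by (rule sum.cong) (simp_all only: ip if_distrib[of "(*) _"] mult_1_right mult_zero_right)
  also have "\<dots> = (\<Sum>i\<in>?J. complex_of_real (c i))"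
    by (rule sum.mono_neutral_cong_right) auto
  also have "\<dots> = complex_of_real (\<Sum>i\<in>?J. word_sum ?D f d (\<sigma> i))"
    unfolding of_real_sum by (rule sum.cong) (auto simp: coeff)
  finally have "complex_of_real (real (multiplicity_rep ?D \<tau> (tensor_power_rep d \<rho>))) =
      complex_of_real (\<Sum>i\<in>?J. word_sum ?D f d (\<sigma> i))" by simp
  then show ?thesis unfolding of_real_eq_iff word_sum_def .
qed

end
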